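(* Let $G$ be a locally compact abelian group. Every Hartman measurable function $\varphi\in\mathcal{H}(G)$ has an aperiodic almost realization on some group compactification $(\iota_X,X)$ of $G$. If $\varphi^*:X\to\mathbb{C}$ is any aperiodic almost realization of $\varphi$ on a group compactification $(\iota_X,X)$, then $\mathcal{F}(\varphi)=\mathfrak{U}_{(\iota_X,X)}$.
   Context: $G$ is a locally compact abelian (LCA) group, written additively. A group compactification of $G$ is a pair $(\iota_X,X)$ with $X$ a compact (Hausdorff) group and $\iota_X:G\to X$ a continuous homomorphism with dense image; $\mu_X$ is the normalized Haar measure on $X$, $0_X$ the unit of $X$. $(\iota_b,bG)$ denotes the Bohr compactification of $G$ (the maximal group compactification). A bounded function $f:X\to\mathbb{C}$ is Riemann integrable, $f\in R_{\mu_X}(X)$, iff its set of points of discontinuity is a $\mu_X$-null set. A bounded function $\varphi:G\to\mathbb{C}$ is Hartman measurable, $\varphi\in\mathcal{H}(G)$, iff $\varphi=\varphi_b\circ\iota_b$ for some $\varphi_b\in R_{\mu_b}(bG)$, where $\mu_b$ is Haar measure on $bG$. A function $\varphi^*$ is a realization of $\varphi$ on $(\iota_X,X)$ iff $\varphi^*\in R_{\mu_X}(X)$ and $\varphi=\varphi^*\circ\iota_X$. There is a unique invariant mean $m_G$ on $\mathcal{H}(G)$, given by $m_G(\varphi)=\int_X\varphi^*\,d\mu_X$ for any realization $\varphi^*$ of $\varphi$. A function $\psi^*\in R_{\mu_X}(X)$ is an almost realization of $\varphi\in\mathcal{H}(G)$ on $(\iota_X,X)$ iff $m_G(|\varphi-\psi|)=0$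 for $\psi:=\psi^*\circ\iota_X$. It is aperiodic iff $\{x\in X:\|\psi^*-\tau_x\psi^*\|_1=0\}=\{0_X\}$, where $\|\cdot\|_1$ is the $L^1(\mu_X)$-norm and $\tau_x\psi^*(y)=\psi^*(x+y)$. For $\varphi\in\mathcal{H}(G)$ put $d_\varphi(g):=m_G(|\varphi-\tau_g\varphi|)$ for $g\in G$ (with $\tau_g\varphi(h)=\varphi(g+h)$), $F(\varphi,\varepsilon):=\{g\in G: d_\varphi(g)<\varepsilon\}$, and let $\mathcal{F}(\varphi)$ be the filter on $G$ generated by $\{F(\varphi,\varepsilon):\varepsilon>0\}$, i.e. the family of all $A\subseteq G$ containing some $F(\varphi,\varepsilon)$, $\varepsilon>0$. For a group compactification $(\iota_X,X)$, $\mathfrak{U}_{(\iota_X,X)}$ is the filter on $G$ generated by the sets $\iota_X^{-1}(U)$, $U$ a neighborhood of $0_X$ in $X$. *)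

theory Defs
  imports "HOL-Analysis.Analysis" "HOL-Algebra.Group"
begin

text \<open>
  The base group is a type of class topological_ab_group_add, written additively. Group
  compactifications are carrier-based, since they have to be quantified over inside formulas;
  they use the multiplicative notation of HOL-Algebra, so the unit \<open>0\<^sub>X\<close> is \<open>\<one>\<^bsub>X\<^esub>\<close>.
\<close>

record 'x top_group = "'x monoid" +
  topol :: "'x topology"

definition compact_group :: "'x top_group \<Rightarrow> bool" where
  "compact_group X \<longleftrightarrow>
     group X \<and> topspace (topol X) = carrier X \<and>
     continuous_map (prod_topology (topol X) (topol X)) (topol X) (\<lambda>(x, y). x \<otimes>\<^bsub>X\<^esub> y) \<and>
     continuous_map (topol X) (topol X) (\<lambda>x. inv\<^bsub>X\<^esub> x) \<and>
     compact_space (topol X) \<and> Hausdorff_space (topol X)"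

definition group_compactification ::
    "'x top_group \<Rightarrow> ('g::topological_ab_group_add \<Rightarrow> 'x) \<Rightarrow> bool" where
  "group_compactification X \<iota> \<longleftrightarrow>
     compact_group X \<and>
     \<iota> \<in> hom \<lparr>carrier = UNIV, mult = (+), one = 0\<rparr> X \<and>
     continuous_map euclidean (topol X) \<iota> \<and>
     topol X closure_of (range \<iota>) = carrier X"

text \<open>
  A point of a compactification is determined by the trace on the base group of its
  neighborhood filter. Hence every group compactification of a group of type \<open>'g\<close>,
  whatever its own carrier type, is isomorphic to one whose carrier is a subset of
  \<open>'g set set\<close>. Quantifiers over all group compactifications that occur in definitions,
  and the existential one in the theorem, therefore range over this type.
\<close>

definition trace_filter :: "'x top_group \<Rightarrow> ('g \<Rightarrow> 'x) \<Rightarrow> 'x \<Rightarrow> 'g set set" where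
  "trace_filter X \<iota> x = {A. \<exists>U. openin (topol X) U \<and> x \<in> U \<and> \<iota> -` U \<subseteq> A}"

lemma inj_on_trace_filter:
  fixes \<iota> :: "'g::topological_ab_group_add \<Rightarrow> 'x"
  assumes X: "group_compactification X \<iota>"
  shows "inj_on (trace_filter X \<iota>) (carrier X)"
proof (rule inj_onI, rule ccontr)
  fix x y
  assume x: "x \<in> carrier X" and y: "y \<in> carrier X" and "x \<noteq> y"
    and eq: "trace_filter X \<iota> x = trace_filter X \<iota> y"
  have haus: "Hausdorff_space (topol X)" and ts: "topspace (topol X) = carrier X"
    and dense: "topol X closure_of (range \<iota>) = carrier X"
    using X by (auto simp: group_compactification_def compact_group_def)
  obtain U V where U: "openin (topol X) U" "x \<in> U" and V: "openin (topol X) V" "y \<in> V"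
    and disj: "disjnt U V"
    using haus[unfolded Hausdorff_space_def, rule_format, of x y] x y \<open>x \<noteq> y\<close> ts by blast
  have "\<iota> -` V \<in> trace_filter X \<iota> y"
    using V by (auto simp: trace_filter_def)
  then obtain W where W: "openin (topol X) W" "x \<in> W" "\<iota> -` W \<subseteq> \<iota> -` V"
    unfolding eq[symmetric] by (auto simp: trace_filter_def)
  have "openin (topol X) (U \<inter> W)" "x \<in> U \<inter> W"
    using U W by auto
  moreover have "x \<in> topol X closure_of (range \<iota>)"
    using x dense by simp
  ultimately obtain g where "\<iota> g \<in> U \<inter> W"
    unfolding in_closure_of by blast
  then show False
    using W disj by (auto simp: disjnt_iff)
qed

text \<open>
  The Bohr compactification, characterized up to isomorphism by maximality.
\<close>

definition bohr_compactification ::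
    "'x top_group \<Rightarrow> ('g::topological_ab_group_add \<Rightarrow> 'x) \<Rightarrow> bool" where
  "bohr_compactification B \<iota>b \<longleftrightarrow>
     group_compactification B \<iota>b \<and>
     (\<forall>(Y :: 'g set set top_group) \<kappa>. group_compactification Y \<kappa> \<longrightarrow>
        (\<exists>\<pi>. \<pi> \<in> hom B Y \<and> continuous_map (topol B) (topol Y) \<pi> \<and> (\<forall>g. \<pi> (\<iota>b g) = \<kappa> g)))"

text \<open>
  The normalized Haar measure, as a regular measure on the Borel sets. Regularity is needed
  for uniqueness because the topology need not be second countable. A compact group has
  exactly one such measure, so quantifying over it existentially amounts to naming it.
\<close>

definition haar_measure :: "'x top_group \<Rightarrow> 'x measure \<Rightarrow> bool" where
  "haar_measure X \<mu> \<longleftrightarrow>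
     space \<mu> = carrier X \<and>
     sets \<mu> = sigma_sets (carrier X) {U. openin (topol X) U} \<and>
     emeasure \<mu> (carrier X) = 1 \<and>
     (\<forall>x\<in>carrier X. \<forall>A\<in>sets \<mu>. emeasure \<mu> ((\<lambda>y. x \<otimes>\<^bsub>X\<^esub> y) ` A) = emeasure \<mu> A) \<and>
     (\<forall>A\<in>sets \<mu>. emeasure \<mu> A = (INF U\<in>{U. openin (topol X) U \<and> A \<subseteq> U}. emeasure \<mu> U)) \<and>
     (\<forall>U. openin (topol X) U \<longrightarrow>
        emeasure \<mu> U = (SUP K\<in>{K. compactin (topol X) K \<and> K \<subseteq> U}. emeasure \<mu> K))"

definition riemann_integrable :: "'x top_group \<Rightarrow> 'x measure \<Rightarrow> ('x \<Rightarrow> complex) \<Rightarrow> bool" where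
  "riemann_integrable X \<mu> f \<longleftrightarrow>
     bounded (f ` carrier X) \<and>
     {x \<in> carrier X. \<not> topcontinuous_at (topol X) euclidean f x} \<in> null_sets \<mu>"

definition realization ::
    "'x top_group \<Rightarrow> ('g \<Rightarrow> 'x) \<Rightarrow> 'x measure \<Rightarrow> ('x \<Rightarrow> complex) \<Rightarrow> ('g \<Rightarrow> complex) \<Rightarrow> bool" where
  "realization X \<iota> \<mu> \<phi>s \<phi> \<longleftrightarrow> riemann_integrable X \<mu> \<phi>s \<and> \<phi> = \<phi>s \<circ> \<iota>"

definition hartman_measurable :: "('g::topological_ab_group_add \<Rightarrow> complex) \<Rightarrow> bool" where
  "hartman_measurable \<phi> \<longleftrightarrow>
     bounded (range \<phi>) \<and>
     (\<exists>(B :: 'g set set top_group) \<iota>b \<mu>b \<phi>b.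
        bohr_compactification B \<iota>b \<and> haar_measure B \<mu>b \<and> realization B \<iota>b \<mu>b \<phi>b \<phi>)"

text \<open>
  A Riemann integrable function is measurable only with respect to the completion of the
  Haar measure, so integrals are taken with respect to the completion. The integral in the
  mean does not depend on the realization or on the compactification.
\<close>

definition hartman_mean :: "('g::topological_ab_group_add \<Rightarrow> complex) \<Rightarrow> complex" where
  "hartman_mean \<phi> = (THE c. \<exists>(X :: 'g set set top_group) \<iota> \<mu> \<phi>s.
     group_compactification X \<iota> \<and> haar_measure X \<mu> \<and> realization X \<iota> \<mu> \<phi>s \<phi> \<and>
     c = (LINT x|completion \<mu>. \<phi>s x))"

definition almost_realization ::
    "'x top_group \<Rightarrow> ('g::topological_ab_group_add \<Rightarrow> 'x) \<Rightarrow> 'x measure \<Rightarrow>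
     ('x \<Rightarrow> complex) \<Rightarrow> ('g \<Rightarrow> complex) \<Rightarrow> bool" where
  "almost_realization X \<iota> \<mu> \<psi>s \<phi> \<longleftrightarrow>
     riemann_integrable X \<mu> \<psi>s \<and>
     hartman_mean (\<lambda>g. complex_of_real (cmod (\<phi> g - (\<psi>s \<circ> \<iota>) g))) = 0"

definition L1_norm :: "'x measure \<Rightarrow> ('x \<Rightarrow> complex) \<Rightarrow> real" where
  "L1_norm \<mu> f = (LINT x|completion \<mu>. cmod (f x))"

definition aperiodic :: "'x top_group \<Rightarrow> 'x measure \<Rightarrow> ('x \<Rightarrow> complex) \<Rightarrow> bool" where
  "aperiodic X \<mu> \<psi>s \<longleftrightarrow>
     {x \<in> carrier X. L1_norm \<mu> (\<lambda>y. \<psi>s y - \<psi>s (x \<otimes>\<^bsub>X\<^esub> y)) = 0} = {\<one>\<^bsub>X\<^esub>}"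

definition hartman_dist :: "('g::topological_ab_group_add \<Rightarrow> complex) \<Rightarrow> 'g \<Rightarrow> real" where
  "hartman_dist \<phi> g = Re (hartman_mean (\<lambda>h. complex_of_real (cmod (\<phi> h - \<phi> (g + h)))))"

definition hartman_filter :: "('g::topological_ab_group_add \<Rightarrow> complex) \<Rightarrow> 'g filter" where
  "hartman_filter \<phi> = (INF \<epsilon>\<in>{0<..}. principal {g. hartman_dist \<phi> g < \<epsilon>})"

lemma eventually_hartman_filter:
  "eventually P (hartman_filter \<phi>) \<longleftrightarrow> (\<exists>\<epsilon>>0. {g. hartman_dist \<phi> g < \<epsilon>} \<subseteq> Collect P)"
  unfolding hartman_filter_def
proof (subst eventually_INF_base)
  show "({0<..} :: real set) \<noteq> {}" by auto
next
  fix a b :: real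
  assume "a \<in> {0<..}" "b \<in> {0<..}"
  then show "\<exists>x\<in>{0<..}. principal {g. hartman_dist \<phi> g < x}
      \<le> inf (principal {g. hartman_dist \<phi> g < a}) (principal {g. hartman_dist \<phi> g < b})"
    by (intro bexI[of _ "min a b"]) auto
qed (auto simp: eventually_principal)

definition compactification_filter :: "'x top_group \<Rightarrow> ('g \<Rightarrow> 'x) \<Rightarrow> 'g filter" where
  "compactification_filter X \<iota> =
     (INF U\<in>{U. U \<subseteq> carrier X \<and> (\<exists>V. openin (topol X) V \<and> \<one>\<^bsub>X\<^esub> \<in> V \<and> V \<subseteq> U)}.
        principal (\<iota> -` U))"

end

theory Submission
  imports Defs
begin

text \<open>
  Let \<open>\<phi> = f \<circ> \<iota>b\<close> with \<open>f\<close> Riemann integrable on the Bohr compactification \<open>B\<close>. Everything is read off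
  from the function \<open>D x = \<parallel>f - \<tau>\<^sub>x f\<parallel>\<^sub>1\<close> on \<open>B\<close>. It is symmetric and subadditive, and it is continuous
  (\<open>L1_shift_continuous\<close>) because translation by a small element moves a bounded, almost everywhere
  continuous function little, outside an open set of small measure. So its zeros, the periods of
  \<open>f\<close> in the mean, form a closed subgroup \<open>N\<close>.

  Existence. On \<open>X = B / N\<close> let \<open>F\<close> assign to a point some cluster value of \<open>f\<close> along the fibre over it,
  taken through continuity points of \<open>f\<close>. Since elements of \<open>N\<close> change \<open>f\<close> only on null sets, the cluster
  value over a continuity point of \<open>f\<close> is unique; hence \<open>F\<close> is continuous almost everywhere and pulls
  back to \<open>f\<close> almost everywhere (\<open>descent\<close>). It is aperiodic because all periods have been divided out.

  The filters. Let \<open>F\<close> be any aperiodic almost realization on some \<open>X\<close>. Pulling back to \<open>B\<close> shows that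
  \<open>d\<^sub>\<phi> g\<close> is the value at \<open>\<iota> g\<close> of the corresponding function \<open>D\<close> for \<open>F\<close> on \<open>X\<close>. This function is continuous,
  and by aperiodicity it vanishes only at the unit, so by compactness the sets \<open>{x. D x < \<epsilon>}\<close> form a
  neighborhood base of the unit. Their preimages under \<open>\<iota>\<close> generate both filters.

  Both parts compare integrals on different compactifications, and the mean of a function on the
  base group has to be independent of the realization. Two facts achieve this. A Riemann integrable
  function is determined almost everywhere by its values on a dense set (\<open>riemann_integrable_eq_AE\<close>).
  And the projection of \<open>B\<close> onto \<open>X\<close> carries Haar measure to Haar measure, since the image measure is
  a Haar measure (\<open>haar_measure_distr\<close>) and there is only one (\<open>haar_measure_unique\<close>): the integral of a
  continuous function is a uniform limit of averages of its translates, and such averages have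
  the same integral for every invariant measure (\<open>haar_averaging\<close>).
\<close>

section \<open>Points of discontinuity\<close>

lemma topcontinuous_at_dist:
  fixes f :: "'a \<Rightarrow> 'b::metric_space"
  shows "topcontinuous_at T euclidean f x \<longleftrightarrow>
    x \<in> topspace T \<and> (\<forall>e>0. \<exists>U. openin T U \<and> x \<in> U \<and> (\<forall>y\<in>U. dist (f y) (f x) < e))"
proof (intro iffI conjI allI impI)
  assume f: "topcontinuous_at T euclidean f x"
  then show "x \<in> topspace T" by (simp add: topcontinuous_at_def)
  fix e :: real assume "e > 0"
  then have "openin euclidean (ball (f x) e) \<and> f x \<in> ball (f x) e" by auto
  then obtain U where "openin T U" "x \<in> U" "\<forall>y\<in>U. f y \<in> ball (f x) e"
    using f unfolding topcontinuous_at_def by blast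
  then show "\<exists>U. openin T U \<and> x \<in> U \<and> (\<forall>y\<in>U. dist (f y) (f x) < e)"
    by (auto simp: dist_commute intro!: exI[of _ U])
next
  assume *: "x \<in> topspace T \<and> (\<forall>e>0. \<exists>U. openin T U \<and> x \<in> U \<and> (\<forall>y\<in>U. dist (f y) (f x) < e))"
  have "\<exists>U. openin T U \<and> x \<in> U \<and> (\<forall>y\<in>U. f y \<in> V)" if "open V" "f x \<in> V" for V
  proof -
    obtain e where "e > 0" "\<forall>z. dist z (f x) < e \<longrightarrow> z \<in> V"
      using \<open>open V\<close> \<open>f x \<in> V\<close> open_dist by blast
    with * show ?thesis by meson
  qed
  with * show "topcontinuous_at T euclidean f x"
    unfolding topcontinuous_at_def by auto
qed

text \<open>
  The points where the oscillation is below \<open>1/n\<close> form an open set, so the continuity set is a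
  countable intersection of open sets. Riemann integrability asks the discontinuity set to be
  a Borel null set; this lemma supplies the Borel part for every function, so that only a null
  superset has to be found.
\<close>

lemma sets_discontinuities:
  fixes f :: "'a \<Rightarrow> 'b::metric_space"
  assumes \<mu>: "sets \<mu> = sigma_sets (topspace T) {U. openin T U}"
  shows "{x \<in> topspace T. \<not> topcontinuous_at T euclidean f x} \<in> sets \<mu>"
proof -
  define Op where "Op n = \<Union>{U. openin T U \<and> (\<forall>y\<in>U. \<forall>z\<in>U. dist (f y) (f z) < 1 / real (Suc n))}" for n
  have op: "openin T (Op n)" for n
    unfolding Op_def by (rule openin_Union) auto
  have "topcontinuous_at T euclidean f x \<longleftrightarrow> (\<forall>n. x \<in> Op n)" for x
  proof (intro iffI allI)
    fix n
    assume "topcontinuous_at T euclidean f x"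
    moreover have "1 / real (Suc n) / 2 > 0" by simp
    ultimately obtain U where U: "openin T U" "x \<in> U" "\<forall>y\<in>U. dist (f y) (f x) < 1 / real (Suc n) / 2"
      unfolding topcontinuous_at_dist by blast
    have "\<forall>y\<in>U. \<forall>z\<in>U. dist (f y) (f z) < 1 / real (Suc n)"
      using U(3) dist_triangle_half_l by blast
    with U show "x \<in> Op n" unfolding Op_def by blast
  next
    assume *: "\<forall>n. x \<in> Op n"
    show "topcontinuous_at T euclidean f x"
      unfolding topcontinuous_at_dist
    proof (intro conjI allI impI)
      show "x \<in> topspace T" using * op[of 0] openin_subset by blast
      fix e :: real assume "e > 0"
      then obtain n where n: "1 / real (Suc n) < e"
        using nat_approx_posE by blast
      from * have "x \<in> Op n" by blast
      then obtain U where "openin T U" "x \<in> U" "\<forall>y\<in>U. \<forall>z\<in>U. dist (f y) (f z) < 1 / real (Suc n)"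
        unfolding Op_def by blast
      with n show "\<exists>U. openin T U \<and> x \<in> U \<and> (\<forall>y\<in>U. dist (f y) (f x) < e)"
        by (intro exI[of _ U]) (auto intro: less_trans)
    qed
  qed
  then have "{x \<in> topspace T. \<not> topcontinuous_at T euclidean f x} = topspace T - (\<Inter>n. Op n)"
    by blast
  also have "\<dots> = (\<Union>n. topspace T - Op n)" by blast
  also have "\<dots> \<in> sets \<mu>"
  proof -
    have "topspace T - Op n \<in> sets \<mu>" for n
      unfolding \<mu> by (intro sigma_sets.Compl sigma_sets.Basic) (simp add: op)
    then show ?thesis by (intro sets.countable_UN) auto
  qed
  finally show ?thesis .
qed

section \<open>Compact abelian groups\<close>

locale compact_ab_group = comm_group X for X :: "'x top_group" (structure) +
  assumes compact_group: "compact_group X"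
begin

abbreviation "T \<equiv> topol X"

lemma topspace [simp]: "topspace T = carrier X"
  and mult_cont: "continuous_map (prod_topology T T) T (\<lambda>(x, y). x \<otimes> y)"
  and inv_cont: "continuous_map T T (\<lambda>x. inv x)"
  and compact: "compact_space T"
  and haus: "Hausdorff_space T"
  using compact_group by (auto simp: compact_group_def)

lemma openin_carrier: "openin T U \<Longrightarrow> U \<subseteq> carrier X"
  using openin_subset by fastforce

lemma closed_complement: "openin T U \<Longrightarrow> closedin T (carrier X - U)"
  using closedin_diff[OF closedin_topspace[of T], of U] by simp

lemma translation_cont: "a \<in> carrier X \<Longrightarrow> continuous_map T T (\<lambda>x. a \<otimes> x)"
  using continuous_map_compose[OF _ mult_cont, of T "\<lambda>x. (a, x)"]
  by (simp add: o_def continuous_map_pairedI)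

lemma translation_image:
  assumes "a \<in> carrier X" "A \<subseteq> carrier X"
  shows "(\<lambda>y. a \<otimes> y) ` A = {y \<in> carrier X. inv a \<otimes> y \<in> A}"
proof (intro equalityI subsetI)
  fix y assume y: "y \<in> {y \<in> carrier X. inv a \<otimes> y \<in> A}"
  then have "y = a \<otimes> (inv a \<otimes> y)" using assms by (simp add: m_assoc[symmetric])
  then show "y \<in> (\<lambda>y. a \<otimes> y) ` A" using y by blast
next
  fix y assume "y \<in> (\<lambda>y. a \<otimes> y) ` A"
  then show "y \<in> {y \<in> carrier X. inv a \<otimes> y \<in> A}"
    using assms by (auto simp: m_assoc[symmetric] subsetD)
qed

lemma open_translation:
  assumes "openin T U" "a \<in> carrier X"
  shows "openin T ((\<lambda>y. a \<otimes> y) ` U)"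
  using openin_continuous_map_preimage[OF translation_cont[of "inv a"] assms(1)] assms
  by (simp add: translation_image openin_carrier)

text \<open>
  This makes nonempty open sets have positive measure, and lets averages over finitely many
  translates approximate integrals.
\<close>

lemma finite_translates_cover:
  assumes U: "openin T U" and "U \<noteq> {}"
  obtains F where "finite F" "F \<subseteq> carrier X" "carrier X \<subseteq> (\<Union>a\<in>F. (\<lambda>y. a \<otimes> y) ` U)"
proof -
  let ?U = "\<lambda>a. (\<lambda>y. a \<otimes> y) ` U"
  obtain x where x: "x \<in> U" "x \<in> carrier X" using assms openin_carrier by blast
  have "carrier X \<subseteq> \<Union>(?U ` carrier X)"
  proof
    fix z assume z: "z \<in> carrier X"
    then have "z = (z \<otimes> inv x) \<otimes> x" using x by (simp add: m_assoc)
    then show "z \<in> \<Union>(?U ` carrier X)" using z x by (intro UN_I[of "z \<otimes> inv x"]) auto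
  qed
  then have "\<exists>\<F>. finite \<F> \<and> \<F> \<subseteq> ?U ` carrier X \<and> carrier X \<subseteq> \<Union>\<F>"
    using compact open_translation[OF U]
    unfolding compact_space_def compactin_def topspace by (auto simp: image_subset_iff)
  then show thesis using that by (metis finite_subset_image)
qed

lemma mult_nbhds:
  assumes W: "openin T W" "a \<otimes> b \<in> W" and ab: "a \<in> carrier X" "b \<in> carrier X"
  obtains U V where "openin T U" "openin T V" "a \<in> U" "b \<in> V" "\<And>u v. u \<in> U \<Longrightarrow> v \<in> V \<Longrightarrow> u \<otimes> v \<in> W"
proof -
  have "openin (prod_topology T T) {p \<in> carrier X \<times> carrier X. (case p of (x, y) \<Rightarrow> x \<otimes> y) \<in> W}"
    using openin_continuous_map_preimage[OF mult_cont W(1)] by simp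
  moreover have "(a, b) \<in> {p \<in> carrier X \<times> carrier X. (case p of (x, y) \<Rightarrow> x \<otimes> y) \<in> W}"
    using W ab by auto
  ultimately obtain U V where "openin T U" "openin T V" "a \<in> U" "b \<in> V"
    "U \<times> V \<subseteq> {p \<in> carrier X \<times> carrier X. (case p of (x, y) \<Rightarrow> x \<otimes> y) \<in> W}"
    unfolding openin_prod_topology_alt by meson
  then show thesis by (intro that[of U V]) auto
qed

text \<open>
  Heine's theorem on uniform continuity, with continuity required only at the points of the
  compact set \<open>K\<close>, while \<open>v \<otimes> y\<close> may leave \<open>K\<close>. In this form it serves continuous functions (\<open>K\<close> the
  whole group) as well as Riemann integrable ones (\<open>K\<close> avoiding the discontinuities).
\<close>

lemma uniform_nbhd:
  fixes f :: "'x \<Rightarrow> 'b::metric_space"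
  assumes K: "compactin T K" and f: "\<And>x. x \<in> K \<Longrightarrow> topcontinuous_at T euclidean f x" and "\<delta> > 0"
  obtains V where "openin T V" "\<one> \<in> V" "\<And>v y. v \<in> V \<Longrightarrow> y \<in> K \<Longrightarrow> dist (f y) (f (v \<otimes> y)) < \<delta>"
proof -
  have Kc: "K \<subseteq> carrier X" using K compactin_subset_topspace by fastforce
  have "\<exists>V W. openin T V \<and> openin T W \<and> \<one> \<in> V \<and> x \<in> W \<and>
      (\<forall>v\<in>V. \<forall>w\<in>W. dist (f (v \<otimes> w)) (f x) < \<delta> / 2)" if x: "x \<in> K" for x
  proof -
    obtain U where U: "openin T U" "x \<in> U" "\<forall>y\<in>U. dist (f y) (f x) < \<delta> / 2"
      using f[OF x] \<open>\<delta> > 0\<close> unfolding topcontinuous_at_dist by (meson half_gt_zero)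
    have xc: "x \<in> carrier X" using x Kc by blast
    then have "\<one> \<otimes> x \<in> U" using U(2) by simp
    then obtain V W where "openin T V" "openin T W" "\<one> \<in> V" "x \<in> W"
      "\<And>v w. v \<in> V \<Longrightarrow> w \<in> W \<Longrightarrow> v \<otimes> w \<in> U"
      using mult_nbhds[OF U(1), of \<one> x] xc by blast
    then show ?thesis using U(3) by blast
  qed
  then obtain V W where VW: "\<And>x. x \<in> K \<Longrightarrow> openin T (V x) \<and> openin T (W x) \<and> \<one> \<in> V x \<and> x \<in> W x \<and>
      (\<forall>v\<in>V x. \<forall>w\<in>W x. dist (f (v \<otimes> w)) (f x) < \<delta> / 2)" by metis
  have "\<forall>U\<in>W ` K. openin T U" "K \<subseteq> \<Union>(W ` K)" using VW by auto
  then have "\<exists>F. finite F \<and> F \<subseteq> W ` K \<and> K \<subseteq> \<Union>F"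
    using K unfolding compactin_def by simp
  then obtain F where F: "finite F" "F \<subseteq> K" "K \<subseteq> (\<Union>x\<in>F. W x)"
    by (metis finite_subset_image)
  define V' where "V' = carrier X \<inter> \<Inter>(V ` F)"
  show thesis
  proof (rule that)
    have "openin T (\<Inter>(insert (carrier X) (V ` F)))"
      using F VW by (intro openin_Inter) (auto intro: openin_topspace[of T, simplified])
    then show "openin T V'" by (simp add: V'_def)
    show "\<one> \<in> V'" using F VW by (auto simp: V'_def)
    fix v y assume v: "v \<in> V'" and y: "y \<in> K"
    then obtain x where x: "x \<in> F" "y \<in> W x" using F by blast
    then have "x \<in> K" using F by blast
    with x v VW have "dist (f (v \<otimes> y)) (f x) < \<delta> / 2" "dist (f (\<one> \<otimes> y)) (f x) < \<delta> / 2"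
      by (auto simp: V'_def)
    moreover have "\<one> \<otimes> y = y" using y Kc by auto
    ultimately show "dist (f y) (f (v \<otimes> y)) < \<delta>"
      by (metis dist_triangle_half_l)
  qed
qed

end

section \<open>Haar measure\<close>

locale haar_group = compact_ab_group X for X :: "'x top_group" (structure) +
  fixes \<mu> :: "'x measure"
  assumes haar: "haar_measure X \<mu>"
begin

lemma space_haar [simp]: "space \<mu> = carrier X"
  and sets_haar: "sets \<mu> = sigma_sets (carrier X) {U. openin T U}"
  and emeasure_carrier: "emeasure \<mu> (carrier X) = 1"
  and haar_translation: "\<And>a A. a \<in> carrier X \<Longrightarrow> A \<in> sets \<mu> \<Longrightarrow>
        emeasure \<mu> ((\<lambda>y. a \<otimes> y) ` A) = emeasure \<mu> A"
  and haar_outer: "\<And>A. A \<in> sets \<mu> \<Longrightarrow> emeasure \<mu> A = (INF U\<in>{U. openin T U \<and> A \<subseteq> U}. emeasure \<mu> U)"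
  and haar_inner: "\<And>U. openin T U \<Longrightarrow> emeasure \<mu> U = (SUP K\<in>{K. compactin T K \<and> K \<subseteq> U}. emeasure \<mu> K)"
  using haar by (auto simp: haar_measure_def)

sublocale finite_measure \<mu>
  by (rule finite_measureI) (simp add: emeasure_carrier)

lemma sets_open [measurable]: "openin T U \<Longrightarrow> U \<in> sets \<mu>"
  by (simp add: sets_haar sigma_sets.Basic)

lemma sets_closed: "closedin T C \<Longrightarrow> C \<in> sets \<mu>"
  by (metis closedin_def double_diff openin_carrier sets_open sets.compl_sets space_haar subset_refl topspace)

lemma continuous_map_measurable:
  assumes f: "continuous_map T S f" and N: "sets N = sigma_sets (space N) {U. openin S U}"
    "space N = topspace S"
  shows "f \<in> \<mu> \<rightarrow>\<^sub>M N"
proof (rule measurable_sigma_sets[OF N(1)])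
  show "{U. openin S U} \<subseteq> Pow (space N)" using openin_subset N by fastforce
  show "f \<in> space \<mu> \<rightarrow> space N"
    using continuous_map_image_subset_topspace[OF f] N by auto
  fix U assume "U \<in> {U. openin S U}"
  then have "openin T {x \<in> carrier X. f x \<in> U}"
    using openin_continuous_map_preimage[OF f] by simp
  moreover have "f -` U \<inter> space \<mu> = {x \<in> carrier X. f x \<in> U}" by auto
  ultimately show "f -` U \<inter> space \<mu> \<in> sets \<mu>" by (simp add: sets_open)
qed

lemma translation_measurable: "a \<in> carrier X \<Longrightarrow> (\<lambda>y. a \<otimes> y) \<in> \<mu> \<rightarrow>\<^sub>M \<mu>"
  by (rule continuous_map_measurable[OF translation_cont]) (auto simp: sets_haar)

lemma distr_translation:
  assumes a: "a \<in> carrier X" shows "distr \<mu> \<mu> (\<lambda>y. a \<otimes> y) = \<mu>"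
proof (rule measure_eqI)
  fix A assume "A \<in> sets (distr \<mu> \<mu> (\<lambda>y. a \<otimes> y))"
  then have A: "A \<in> sets \<mu>" by simp
  then have Ac: "A \<subseteq> carrier X" using sets.sets_into_space by fastforce
  have "emeasure (distr \<mu> \<mu> (\<lambda>y. a \<otimes> y)) A = emeasure \<mu> ((\<lambda>y. a \<otimes> y) -` A \<inter> carrier X)"
    using A a by (simp add: emeasure_distr translation_measurable)
  also have "(\<lambda>y. a \<otimes> y) -` A \<inter> carrier X = (\<lambda>y. inv a \<otimes> y) ` A"
    using translation_image[of "inv a" A] a Ac by auto
  finally show "emeasure (distr \<mu> \<mu> (\<lambda>y. a \<otimes> y)) A = emeasure \<mu> A"
    using a A by (simp add: haar_translation)
qed simp

lemma open_not_null:
  assumes U: "openin T U" and "U \<noteq> {}" shows "U \<notin> null_sets \<mu>"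
proof
  assume null: "U \<in> null_sets \<mu>"
  let ?U = "\<lambda>a. (\<lambda>y. a \<otimes> y) ` U"
  obtain F where F: "finite F" "F \<subseteq> carrier X" "carrier X \<subseteq> (\<Union>a\<in>F. ?U a)"
    using finite_translates_cover[OF assms] .
  have "?U a \<in> null_sets \<mu>" if "a \<in> F" for a
    using that F(2) null haar_translation[of a U] open_translation[OF U, of a] sets_open U
    by (auto simp: null_sets_def)
  then have "(\<Union>a\<in>F. ?U a) \<in> null_sets \<mu>" using F(1) by (simp add: null_sets.finite_UN)
  moreover have "carrier X \<in> sets \<mu>" using sets.top[of \<mu>] by simp
  ultimately have "carrier X \<in> null_sets \<mu>" using F(3) null_sets_subset by blast
  then show False using emeasure_carrier by (simp add: null_sets_def)
qed

text \<open>
  Complements of null sets are dense. In particular a Riemann integrable function has continuity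
  points in every nonempty open set.
\<close>

lemma ex_not_in_null_set:
  assumes "openin T U" "U \<noteq> {}" "N \<in> null_sets \<mu>"
  obtains x where "x \<in> U" "x \<notin> N"
  using assms open_not_null null_sets_subset[OF assms(3), of U] sets_open by blast

end

section \<open>Uniqueness of Haar measure\<close>

context haar_group
begin

lemma integrable_indicator: "A \<in> sets \<mu> \<Longrightarrow> integrable \<mu> (indicat_real A)"
  by (intro integrable_real_indicator) (auto simp: less_top[symmetric])

lemma continuous_real_integrable:
  fixes f :: "'x \<Rightarrow> real"
  assumes f: "continuous_map T euclideanreal f"
  shows "integrable \<mu> f"
proof -
  have "compactin euclideanreal (f ` carrier X)"
    using image_compactin[OF _ f, of "carrier X"] compact by (simp add: compact_space_def)
  then have "bounded (f ` carrier X)" by (simp add: compact_imp_bounded)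
  then obtain B where B: "\<And>x. x \<in> carrier X \<Longrightarrow> norm (f x) \<le> B"
    unfolding bounded_iff by auto
  have "f \<in> borel_measurable \<mu>"
    by (rule continuous_map_measurable[OF f]) (auto simp: borel_def)
  then show ?thesis by (intro integrable_const_bound[of _ B] AE_I2) (use B in auto)
qed

text \<open>
  The integral is a uniform limit of convex combinations of translates. With \<open>V\<close> from uniform
  continuity, cover the group by translates \<open>a \<otimes> V\<close>, choose measurably for each \<open>x\<close> one centre \<open>s x\<close> with
  \<open>x \<in> s x \<otimes> V\<close>, and compare \<open>f (y \<otimes> x)\<close>, whose mean over \<open>x\<close> is the integral, with \<open>f (s x \<otimes> y)\<close>, whose
  mean is a finite combination with weights \<open>\<mu> {x. s x = a}\<close>. Only one measure integrates here,
  so no product measure is needed; on a group without countable base, a continuous function of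
  two variables need not be measurable for the product of the Borel \<open>\<sigma>\<close>-algebras.
\<close>

lemma haar_averaging:
  fixes f :: "'x \<Rightarrow> real"
  assumes f: "continuous_map T euclideanreal f" and "\<epsilon> > 0"
  obtains F m where "finite F" "F \<subseteq> carrier X" "(\<Sum>a\<in>F. m a) = 1"
    "\<And>y. y \<in> carrier X \<Longrightarrow> \<bar>(LINT x|\<mu>. f x) - (\<Sum>a\<in>F. m a * f (a \<otimes> y))\<bar> \<le> \<epsilon>"
proof -
  have "compactin T (carrier X)" using compact by (simp add: compact_space_def)
  moreover have "topcontinuous_at T euclidean f x" if "x \<in> carrier X" for x
    using f that by (simp add: continuous_map_eq_topcontinuous_at)
  ultimately obtain V where V: "openin T V" "\<one> \<in> V"
    "\<And>v y. v \<in> V \<Longrightarrow> y \<in> carrier X \<Longrightarrow> dist (f y) (f (v \<otimes> y)) < \<epsilon>"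
    using uniform_nbhd[of "carrier X" f \<epsilon>] \<open>\<epsilon> > 0\<close> by metis
  let ?U = "\<lambda>a. (\<lambda>y. a \<otimes> y) ` V"
  obtain F where F: "finite F" "F \<subseteq> carrier X" "carrier X \<subseteq> (\<Union>a\<in>F. ?U a)"
    using finite_translates_cover[OF V(1)] V(2) by blast
  have U_sets: "?U a \<in> sets \<mu>" if "a \<in> F" for a
    using open_translation[OF V(1), of a] that F(2) sets_open by blast
  \<comment> \<open>The centre depends on \<open>x\<close> only through the finite set of translates containing \<open>x\<close>; this
      makes the choice measurable.\<close>
  define c where "c P = (SOME a. a \<in> P)" for P :: "'x set"
  define s where "s x = c {a \<in> F. x \<in> ?U a}" for x
  have s: "s x \<in> F" "x \<in> ?U (s x)" if "x \<in> carrier X" for x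
  proof -
    have "{a \<in> F. x \<in> ?U a} \<noteq> {}" using that F(3) by blast
    then have "s x \<in> {a \<in> F. x \<in> ?U a}" unfolding s_def c_def some_in_eq .
    then show "s x \<in> F" "x \<in> ?U (s x)" by auto
  qed
  define A where "A a = {x \<in> carrier X. s x = a}" for a
  have A_sets: "A a \<in> sets \<mu>" for a
  proof -
    have "A a = (\<Union>P\<in>{P \<in> Pow F. c P = a}. {x \<in> space \<mu>. \<forall>b\<in>F. x \<in> ?U b \<longleftrightarrow> b \<in> P})"
    proof (intro equalityI subsetI)
      fix x assume "x \<in> A a"
      then show "x \<in> (\<Union>P\<in>{P \<in> Pow F. c P = a}. {x \<in> space \<mu>. \<forall>b\<in>F. x \<in> ?U b \<longleftrightarrow> b \<in> P})"
        by (intro UN_I[of "{a \<in> F. x \<in> ?U a}"]) (auto simp: A_def s_def)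
    next
      fix x assume "x \<in> (\<Union>P\<in>{P \<in> Pow F. c P = a}. {x \<in> space \<mu>. \<forall>b\<in>F. x \<in> ?U b \<longleftrightarrow> b \<in> P})"
      then obtain P where P: "P \<subseteq> F" "c P = a" "x \<in> carrier X" "\<forall>b\<in>F. x \<in> ?U b \<longleftrightarrow> b \<in> P" by auto
      then have "P = {a \<in> F. x \<in> ?U a}" by blast
      then show "x \<in> A a" using P by (auto simp: A_def s_def)
    qed
    also have "\<dots> \<in> sets \<mu>"
    proof (intro sets.finite_UN)
      show "finite {P \<in> Pow F. c P = a}" using F(1) by simp
      fix P
      have "{x \<in> space \<mu>. x \<in> ?U b \<longleftrightarrow> b \<in> P} \<in> sets \<mu>" if "b \<in> F" for b
      proof -
        have "{x \<in> space \<mu>. x \<in> ?U b \<longleftrightarrow> b \<in> P} = (if b \<in> P then ?U b else space \<mu> - ?U b)"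
          using sets.sets_into_space[OF U_sets[OF that]] by auto
        then show ?thesis
          using U_sets[OF that] sets.compl_sets[OF U_sets[OF that]] by (simp del: space_haar)
      qed
      then show "{x \<in> space \<mu>. \<forall>b\<in>F. x \<in> ?U b \<longleftrightarrow> b \<in> P} \<in> sets \<mu>"
        using F(1) by (intro sets.sets_Collect_finite_All) auto
    qed
    finally show ?thesis .
  qed
  define m where "m a = measure \<mu> (A a)" for a
  have step: "integrable \<mu> (\<lambda>x. h (s x)) \<and> (LINT x|\<mu>. h (s x)) = (\<Sum>a\<in>F. m a * h a)" for h :: "'x \<Rightarrow> real"
  proof -
    have "h (s x) = (\<Sum>a\<in>F. indicator (A a) x * h a)" if "x \<in> space \<mu>" for x
    proof -
      have "(\<Sum>a\<in>F. indicator (A a) x * h a) = (\<Sum>a\<in>F. if a = s x then h a else 0)"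
        using that by (intro sum.cong) (auto simp: A_def indicator_def)
      also have "\<dots> = h (s x)" using F(1) s(1) that by simp
      finally show ?thesis by simp
    qed
    then have eq: "integrable \<mu> (\<lambda>x. h (s x)) \<longleftrightarrow> integrable \<mu> (\<lambda>x. \<Sum>a\<in>F. indicator (A a) x * h a)"
      "(LINT x|\<mu>. h (s x)) = (LINT x|\<mu>. (\<Sum>a\<in>F. indicator (A a) x * h a))"
      by (auto intro!: Bochner_Integration.integrable_cong Bochner_Integration.integral_cong)
    have int: "integrable \<mu> (\<lambda>x. indicator (A a) x * h a)" for a
      using A_sets by (intro integrable_mult_left integrable_indicator) auto
    have "(LINT x|\<mu>. (\<Sum>a\<in>F. indicator (A a) x * h a)) = (\<Sum>a\<in>F. m a * h a)"
      using int A_sets sets.sets_into_space[OF A_sets] by (simp add: m_def Int_absorb2)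
    then show ?thesis using eq int by simp
  qed
  show thesis
  proof (rule that[of F m])
    show "(\<Sum>a\<in>F. m a) = 1"
      using step[of "\<lambda>_. 1"] emeasure_carrier by (simp add: measure_def)
    fix y assume y: "y \<in> carrier X"
    have fy: "continuous_map T euclideanreal (\<lambda>x. f (y \<otimes> x))"
      using continuous_map_compose[OF translation_cont[OF y] f] by (simp add: o_def)
    have fm: "f \<in> borel_measurable \<mu>"
      using continuous_real_integrable[OF f] by auto
    have eq1: "(LINT x|\<mu>. f x) = (LINT x|\<mu>. f (y \<otimes> x))"
      using integral_distr[OF translation_measurable[OF y] fm] distr_translation[OF y] by simp
    have "\<bar>f (y \<otimes> x) - f (s x \<otimes> y)\<bar> \<le> \<epsilon>" if x: "x \<in> carrier X" for x
    proof -
      obtain v where v: "v \<in> V" "x = s x \<otimes> v" using s(2)[OF x] by blast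
      have c: "v \<in> carrier X" "s x \<in> carrier X"
        using v V(1) openin_carrier s(1)[OF x] F(2) by blast+
      have "y \<otimes> (s x \<otimes> v) = v \<otimes> (s x \<otimes> y)"
        using c y by (simp add: m_ac)
      then have "y \<otimes> x = v \<otimes> (s x \<otimes> y)" using v(2) by simp
      then show ?thesis using V(3)[OF v(1), of "s x \<otimes> y"] c y
        by (simp add: dist_real_def abs_minus_commute)
    qed
    then have "\<bar>LINT x|\<mu>. f (y \<otimes> x) - f (s x \<otimes> y)\<bar> \<le> (LINT x|\<mu>. \<epsilon>)"
      using step[of "\<lambda>a. f (a \<otimes> y)"] continuous_real_integrable[OF fy]
      by (intro order_trans[OF integral_abs_bound] integral_mono) auto
    also have "(LINT x|\<mu>. f (y \<otimes> x) - f (s x \<otimes> y)) =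
        (LINT x|\<mu>. f (y \<otimes> x)) - (LINT x|\<mu>. f (s x \<otimes> y))"
      using step[of "\<lambda>a. f (a \<otimes> y)"] continuous_real_integrable[OF fy]
      by (intro Bochner_Integration.integral_diff) auto
    also have "\<dots> = (LINT x|\<mu>. f x) - (\<Sum>a\<in>F. m a * f (a \<otimes> y))"
      using eq1 step[of "\<lambda>a. f (a \<otimes> y)"] by simp
    finally show "\<bar>(LINT x|\<mu>. f x) - (\<Sum>a\<in>F. m a * f (a \<otimes> y))\<bar> \<le> \<epsilon>"
      using emeasure_carrier by (simp add: measure_def)
  qed (use F in auto)
qed

end

text \<open>
  Integrate the uniform approximation of \<open>\<integral>f d\<mu>\<close> by convex combinations of translates with respect to
  the other measure \<open>\<nu>\<close>: each translate contributes \<open>\<integral>f d\<nu>\<close>.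
\<close>

lemma (in compact_ab_group) haar_integral_unique:
  fixes f :: "'x \<Rightarrow> real"
  assumes \<mu>: "haar_measure X \<mu>" and \<nu>: "haar_measure X \<nu>"
    and f: "continuous_map T euclideanreal f"
  shows "(LINT x|\<mu>. f x) = (LINT x|\<nu>. f x)"
proof -
  interpret \<mu>: haar_group X \<mu> by unfold_locales fact
  interpret \<nu>: haar_group X \<nu> by unfold_locales fact
  have "\<bar>(LINT x|\<mu>. f x) - (LINT x|\<nu>. f x)\<bar> \<le> \<epsilon>" if "\<epsilon> > 0" for \<epsilon>
  proof -
    obtain F m where F: "finite F" "F \<subseteq> carrier X" "(\<Sum>a\<in>F. m a) = 1"
      "\<And>y. y \<in> carrier X \<Longrightarrow> \<bar>(LINT x|\<mu>. f x) - (\<Sum>a\<in>F. m a * f (a \<otimes> y))\<bar> \<le> \<epsilon>"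
      using \<mu>.haar_averaging[OF f \<open>\<epsilon> > 0\<close>] by blast
    have int: "integrable \<nu> (\<lambda>y. f (a \<otimes> y))" "(LINT y|\<nu>. f (a \<otimes> y)) = (LINT y|\<nu>. f y)"
      if a: "a \<in> F" for a
    proof -
      have a: "a \<in> carrier X" using a F(2) by blast
      show "integrable \<nu> (\<lambda>y. f (a \<otimes> y))"
        using continuous_map_compose[OF translation_cont[OF a] f]
        by (intro \<nu>.continuous_real_integrable) (simp add: o_def)
      show "(LINT y|\<nu>. f (a \<otimes> y)) = (LINT y|\<nu>. f y)"
        using integral_distr[OF \<nu>.translation_measurable[OF a], of f] \<nu>.distr_translation[OF a]
          \<nu>.continuous_real_integrable[OF f] by auto
    qed
    have "(LINT y|\<nu>. (\<Sum>a\<in>F. m a * f (a \<otimes> y))) = (\<Sum>a\<in>F. m a * (LINT y|\<nu>. f y))"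
      using int by (subst Bochner_Integration.integral_sum) (auto intro!: sum.cong)
    also have "\<dots> = (LINT y|\<nu>. f y)"
      using F(3) by (simp add: sum_distrib_right[symmetric])
    finally have "(LINT x|\<mu>. f x) - (LINT x|\<nu>. f x) =
        (LINT y|\<nu>. (LINT x|\<mu>. f x) - (\<Sum>a\<in>F. m a * f (a \<otimes> y)))"
      using int \<nu>.emeasure_carrier
      by (subst Bochner_Integration.integral_diff) (auto simp: measure_def)
    also have "\<bar>\<dots>\<bar> \<le> (LINT y|\<nu>. \<epsilon>)"
      using F(4) int
      by (intro order_trans[OF integral_abs_bound] integral_mono) auto
    finally show ?thesis using \<nu>.emeasure_carrier by (simp add: measure_def)
  qed
  then show ?thesis using field_le_epsilon[of "\<bar>(LINT x|\<mu>. f x) - (LINT x|\<nu>. f x)\<bar>" 0] by simp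
qed

text \<open>
  Inner regularity reduces to a compact \<open>K \<subseteq> U\<close>, and Urysohn's lemma puts a continuous function
  between the indicators of \<open>K\<close> and \<open>U\<close>.
\<close>

lemma (in compact_ab_group) haar_measure_open_le:
  assumes \<mu>: "haar_measure X \<mu>" and \<nu>: "haar_measure X \<nu>" and U: "openin T U"
  shows "emeasure \<mu> U \<le> emeasure \<nu> U"
proof -
  interpret \<mu>: haar_group X \<mu> by unfold_locales fact
  interpret \<nu>: haar_group X \<nu> by unfold_locales fact
  have "emeasure \<mu> K \<le> emeasure \<nu> U" if K: "compactin T K" "K \<subseteq> U" for K
  proof -
    have K': "closedin T K" using compactin_imp_closedin[OF haus K(1)] .
    have "normal_space T" using compact haus by (simp add: compact_Hausdorff_or_regular_imp_normal_space)
    moreover have "closedin T (carrier X - U)" using U by (rule closed_complement)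
    moreover have "disjnt (carrier X - U) K" using K by (auto simp: disjnt_iff)
    ultimately obtain f :: "'x \<Rightarrow> real" where f: "continuous_map T (top_of_set {0..1}) f"
      "f ` (carrier X - U) \<subseteq> {0}" "f ` K \<subseteq> {1}"
      using Urysohn_lemma[of T "carrier X - U" K 0 1] K' by auto
    have fc: "continuous_map T euclideanreal f" and f01: "\<And>x. x \<in> carrier X \<Longrightarrow> f x \<in> {0..1}"
      using f(1) by (auto simp: continuous_map_in_subtopology)
    have Ks: "K \<in> sets \<mu>" "U \<in> sets \<nu>" and Kc: "K \<subseteq> carrier X" "U \<subseteq> carrier X"
      using \<mu>.sets_closed[OF K'] \<nu>.sets_open[OF U] openin_carrier[OF U] K by auto
    have "measure \<mu> K = (LINT x|\<mu>. indicator K x)" using Ks Kc by (simp add: Int_absorb2)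
    also have "\<dots> \<le> (LINT x|\<mu>. f x)"
      using Ks f f01 \<mu>.continuous_real_integrable[OF fc] \<mu>.integrable_indicator
      by (intro integral_mono) (auto split: split_indicator)
    also have "\<dots> = (LINT x|\<nu>. f x)" using \<mu> \<nu> fc by (rule haar_integral_unique)
    also have "\<dots> \<le> (LINT x|\<nu>. indicator U x)"
      using Ks f f01 \<nu>.continuous_real_integrable[OF fc] \<nu>.integrable_indicator
      by (intro integral_mono) (auto split: split_indicator)
    also have "\<dots> = measure \<nu> U" using Ks Kc by (simp add: Int_absorb2)
    finally show ?thesis by (simp add: \<mu>.emeasure_eq_measure \<nu>.emeasure_eq_measure)
  qed
  then show ?thesis unfolding \<mu>.haar_inner[OF U] by (intro SUP_least) auto
qed

lemma (in compact_ab_group) haar_measure_unique: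
  assumes \<mu>: "haar_measure X \<mu>" and \<nu>: "haar_measure X \<nu>"
  shows "\<mu> = \<nu>"
proof (rule measure_eqI)
  interpret \<mu>: haar_group X \<mu> by unfold_locales fact
  interpret \<nu>: haar_group X \<nu> by unfold_locales fact
  show eq: "sets \<mu> = sets \<nu>" by (simp add: \<mu>.sets_haar \<nu>.sets_haar)
  fix A assume A: "A \<in> sets \<mu>"
  then have A': "A \<in> sets \<nu>" using eq by simp
  have "emeasure \<mu> U = emeasure \<nu> U" if "openin T U" for U
    using haar_measure_open_le[OF \<mu> \<nu> that] haar_measure_open_le[OF \<nu> \<mu> that] by simp
  then show "emeasure \<mu> A = emeasure \<nu> A"
    unfolding \<mu>.haar_outer[OF A] \<nu>.haar_outer[OF A'] by (intro INF_cong) auto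
qed

text \<open>
  The preimage of a translate \<open>\<pi> b \<otimes> A\<close> is the translate by \<open>b\<close> of the preimage of \<open>A\<close>, which gives
  invariance. Regularity descends because \<open>\<pi>\<close> is a closed map: an open \<open>W\<close> around the preimage of \<open>A\<close>
  contains the preimage of the open set of points whose whole fibre lies in \<open>W\<close>, and images of
  compact sets are compact.
\<close>

lemma haar_measure_distr:
  fixes B :: "'b top_group" and X :: "'x top_group"
  assumes B: "compact_ab_group B" and X: "compact_ab_group X" and \<mu>: "haar_measure B \<mu>"
    and \<pi>: "\<pi> \<in> hom B X" "continuous_map (topol B) (topol X) \<pi>" "\<pi> ` carrier B = carrier X"
  shows "haar_measure X (distr \<mu> (sigma (carrier X) {U. openin (topol X) U}) \<pi>)"
proof -
  interpret B: haar_group B \<mu> using B \<mu> by (simp add: haar_group_def haar_group_axioms_def)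
  interpret X: compact_ab_group X by fact
  interpret \<pi>: group_hom B X \<pi> by unfold_locales fact
  let ?S = "sigma (carrier X) {U. openin (topol X) U}"
  let ?\<nu> = "distr \<mu> ?S \<pi>"
  have sub: "{U. openin (topol X) U} \<subseteq> Pow (carrier X)" using X.openin_carrier by blast
  have S: "sets ?S = sigma_sets (carrier X) {U. openin (topol X) U}" "space ?S = carrier X"
    using sub by (auto simp: sets_measure_of space_measure_of)
  have meas: "\<pi> \<in> \<mu> \<rightarrow>\<^sub>M ?S"
    using \<pi>(2) by (rule B.continuous_map_measurable) (use S in auto)
  have em: "emeasure ?\<nu> A = emeasure \<mu> {b \<in> carrier B. \<pi> b \<in> A}" if "A \<in> sets ?S" for A
    using that by (simp add: emeasure_distr[OF meas] vimage_def Int_def conj_commute)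
  have vs: "{b \<in> carrier B. \<pi> b \<in> A} \<in> sets \<mu>" if "A \<in> sets ?S" for A
    using measurable_sets[OF meas that] by (simp add: vimage_def Int_def conj_commute)
  have open_S: "U \<in> sets ?S" if "openin (topol X) U" for U
    using that unfolding S by (simp add: sigma_sets.Basic)
  have closed_map: "closed_map (topol B) (topol X) \<pi>"
    using T1_Spaces.continuous_imp_closed_map[OF \<pi>(2) B.compact X.haus] .
  have trans: "emeasure ?\<nu> ((\<lambda>y. x \<otimes>\<^bsub>X\<^esub> y) ` A) = emeasure ?\<nu> A"
    if x: "x \<in> carrier X" and A: "A \<in> sets ?S" for x A
  proof -
    obtain b where b: "b \<in> carrier B" "x = \<pi> b" using x \<pi>(3) by blast
    have Ac: "A \<subseteq> carrier X" using sets.sets_into_space[OF A] S by simp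
    have im: "(\<lambda>y. x \<otimes>\<^bsub>X\<^esub> y) ` A = {y \<in> carrier X. inv\<^bsub>X\<^esub> x \<otimes>\<^bsub>X\<^esub> y \<in> A}"
      using x Ac by (rule X.translation_image)
    have "continuous_map (topol X) (topol X) (\<lambda>y. inv\<^bsub>X\<^esub> x \<otimes>\<^bsub>X\<^esub> y)"
      using x by (intro X.translation_cont) simp
    then have "(\<lambda>y. inv\<^bsub>X\<^esub> x \<otimes>\<^bsub>X\<^esub> y) \<in> ?S \<rightarrow>\<^sub>M ?S"
      using x S
      by (intro measurable_sigma_sets[OF S(1), unfolded S(2)])
        (auto simp: continuous_map_def intro!: open_S simp: vimage_def Int_def conj_commute
           dest: X.openin_carrier)
    then have "(\<lambda>y. inv\<^bsub>X\<^esub> x \<otimes>\<^bsub>X\<^esub> y) -` A \<inter> space ?S \<in> sets ?S" using A by (rule measurable_sets)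
    then have im_S: "(\<lambda>y. x \<otimes>\<^bsub>X\<^esub> y) ` A \<in> sets ?S"
      unfolding im S(2) by (simp add: vimage_def Int_def conj_commute)
    have "{b' \<in> carrier B. \<pi> b' \<in> (\<lambda>y. x \<otimes>\<^bsub>X\<^esub> y) ` A} = {b' \<in> carrier B. inv\<^bsub>B\<^esub> b \<otimes>\<^bsub>B\<^esub> b' \<in> {b \<in> carrier B. \<pi> b \<in> A}}"
      unfolding im using b by auto
    also have "\<dots> = (\<lambda>y. b \<otimes>\<^bsub>B\<^esub> y) ` {b \<in> carrier B. \<pi> b \<in> A}"
      using b by (subst B.translation_image) auto
    finally show ?thesis
      using em[OF im_S] em[OF A] B.haar_translation[OF b(1) vs[OF A]] by simp
  qed
  have outer: "emeasure ?\<nu> A = (INF U\<in>{U. openin (topol X) U \<and> A \<subseteq> U}. emeasure ?\<nu> U)"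
    if A: "A \<in> sets ?S" for A
  proof (rule antisym)
    show "emeasure ?\<nu> A \<le> (INF U\<in>{U. openin (topol X) U \<and> A \<subseteq> U}. emeasure ?\<nu> U)"
      using A by (intro INF_greatest emeasure_mono) (auto simp: open_S)
    have "(INF U\<in>{U. openin (topol X) U \<and> A \<subseteq> U}. emeasure ?\<nu> U) \<le> emeasure \<mu> W"
      if W: "openin (topol B) W" "{b \<in> carrier B. \<pi> b \<in> A} \<subseteq> W" for W
    proof -
      let ?U = "carrier X - \<pi> ` (carrier B - W)"
      have "closedin (topol B) (carrier B - W)" using W(1) by (rule B.closed_complement)
      then have "closedin (topol X) (\<pi> ` (carrier B - W))" using closed_map by (simp add: closed_map_def)
      then have U: "openin (topol X) ?U" by (metis X.topspace openin_diff openin_topspace)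
      have "A \<subseteq> ?U" using W(2) sets.sets_into_space[OF A] S(2) by auto
      then have "(INF U\<in>{U. openin (topol X) U \<and> A \<subseteq> U}. emeasure ?\<nu> U) \<le> emeasure ?\<nu> ?U"
        using U by (intro INF_lower) auto
      also have "\<dots> \<le> emeasure \<mu> W"
        unfolding em[OF open_S[OF U]] using W(1) by (intro emeasure_mono) (auto intro: B.sets_open)
      finally show ?thesis .
    qed
    then show "(INF U\<in>{U. openin (topol X) U \<and> A \<subseteq> U}. emeasure ?\<nu> U) \<le> emeasure ?\<nu> A"
      unfolding em[OF A] B.haar_outer[OF vs[OF A]] by (intro INF_greatest) auto
  qed
  have inner: "emeasure ?\<nu> U = (SUP K\<in>{K. compactin (topol X) K \<and> K \<subseteq> U}. emeasure ?\<nu> K)"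
    if U: "openin (topol X) U" for U
  proof (rule antisym)
    show "(SUP K\<in>{K. compactin (topol X) K \<and> K \<subseteq> U}. emeasure ?\<nu> K) \<le> emeasure ?\<nu> U"
      using U by (intro SUP_least emeasure_mono) (auto simp: open_S)
    have "emeasure \<mu> K \<le> (SUP K\<in>{K. compactin (topol X) K \<and> K \<subseteq> U}. emeasure ?\<nu> K)"
      if K: "compactin (topol B) K" "K \<subseteq> {b \<in> carrier B. \<pi> b \<in> U}" for K
    proof -
      have K': "compactin (topol X) (\<pi> ` K)" using image_compactin[OF K(1) \<pi>(2)] .
      have "openin (topol X) (carrier X - \<pi> ` K)"
        using compactin_imp_closedin[OF X.haus K'] by (simp add: closedin_def)
      then have "carrier X - (carrier X - \<pi> ` K) \<in> sets ?S"
        using open_S sets.compl_sets[of _ ?S] S(2) by metis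
      moreover have "carrier X - (carrier X - \<pi> ` K) = \<pi> ` K" using K(2) by auto
      ultimately have KS: "\<pi> ` K \<in> sets ?S" by simp
      have "emeasure \<mu> K \<le> emeasure ?\<nu> (\<pi> ` K)"
        unfolding em[OF KS] using K(2) vs[OF KS] by (intro emeasure_mono) auto
      also have "\<dots> \<le> (SUP K\<in>{K. compactin (topol X) K \<and> K \<subseteq> U}. emeasure ?\<nu> K)"
        using K K' by (intro SUP_upper) auto
      finally show ?thesis .
    qed
    moreover have "openin (topol B) {b \<in> carrier B. \<pi> b \<in> U}"
      using openin_continuous_map_preimage[OF \<pi>(2) U] by simp
    ultimately show "emeasure ?\<nu> U \<le> (SUP K\<in>{K. compactin (topol X) K \<and> K \<subseteq> U}. emeasure ?\<nu> K)"
      unfolding em[OF open_S[OF U]] by (subst B.haar_inner) (auto intro!: SUP_least)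
  qed
  have "emeasure ?\<nu> (carrier X) = 1"
  proof -
    have "{b \<in> carrier B. \<pi> b \<in> carrier X} = carrier B" by auto
    then show ?thesis
      using em[of "carrier X"] B.emeasure_carrier sets.top[of ?S] S(2) by simp
  qed
  then show ?thesis
    unfolding haar_measure_def
  proof (intro conjI ballI allI impI)
    fix A assume "A \<in> sets ?\<nu>"
    then show "emeasure ?\<nu> A = (INF U\<in>{U. openin (topol X) U \<and> A \<subseteq> U}. emeasure ?\<nu> U)"
      using outer by simp
  next
    fix x A assume "x \<in> carrier X" "A \<in> sets ?\<nu>"
    then show "emeasure ?\<nu> ((\<lambda>y. x \<otimes>\<^bsub>X\<^esub> y) ` A) = emeasure ?\<nu> A"
      using trans by simp
  qed (use S inner in auto)
qed

section \<open>Riemann integrable functions\<close>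

context haar_group
begin

lemma riemann_integrableI:
  assumes "bounded (f ` carrier X)" and N: "N \<in> null_sets \<mu>"
    and "\<And>x. x \<in> carrier X \<Longrightarrow> x \<notin> N \<Longrightarrow> topcontinuous_at T euclidean f x"
  shows "riemann_integrable X \<mu> f"
proof -
  have "{x \<in> carrier X. \<not> topcontinuous_at T euclidean f x} \<in> sets \<mu>"
    using sets_discontinuities[of \<mu> T f] by (simp add: sets_haar)
  moreover have "{x \<in> carrier X. \<not> topcontinuous_at T euclidean f x} \<subseteq> N"
    using assms(3) by blast
  ultimately show ?thesis
    using assms(1) null_sets_subset[OF N] by (auto simp: riemann_integrable_def)
qed

text \<open>
  The preimage of an open set consists of interior points and points of discontinuity. The latter
  form a subset of a null set, hence the completion.
\<close>

lemma riemann_integrable_measurable: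
  assumes f: "riemann_integrable X \<mu> f"
  shows "f \<in> borel_measurable (completion \<mu>)"
proof (rule borel_measurableI)
  fix S :: "complex set" assume "open S"
  define D where "D = {x \<in> carrier X. \<not> topcontinuous_at T euclidean f x}"
  define Op where "Op = \<Union>{U. openin T U \<and> f ` U \<subseteq> S}"
  have "openin T Op" unfolding Op_def by (rule openin_Union) auto
  then have Op: "Op \<in> sets (completion \<mu>)" by (simp add: sets_open)
  have D: "D \<in> null_sets (completion \<mu>)"
    using f by (auto simp: riemann_integrable_def D_def intro: null_sets_completionI)
  have "f -` S \<inter> carrier X - Op \<subseteq> D"
  proof
    fix x assume x: "x \<in> f -` S \<inter> carrier X - Op"
    have "\<not> topcontinuous_at T euclidean f x"
    proof
      assume "topcontinuous_at T euclidean f x"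
      then obtain U where "openin T U" "x \<in> U" "\<forall>y\<in>U. f y \<in> S"
        using x \<open>open S\<close> unfolding topcontinuous_at_def by auto
      then have "x \<in> Op" unfolding Op_def by blast
      then show False using x by blast
    qed
    then show "x \<in> D" using x by (simp add: D_def)
  qed
  then have "f -` S \<inter> carrier X - Op \<in> null_sets (completion \<mu>)"
    using D by (rule null_sets_completion_subset)
  then have "Op \<union> (f -` S \<inter> carrier X - Op) \<in> sets (completion \<mu>)"
    using Op by (intro sets.Un) auto
  also have "Op \<union> (f -` S \<inter> carrier X - Op) = f -` S \<inter> space (completion \<mu>)"
    using openin_carrier by (auto simp: Op_def)
  finally show "f -` S \<inter> space (completion \<mu>) \<in> sets (completion \<mu>)" .
qed

lemma finite_measure_completion: "finite_measure (completion \<mu>)"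
  using sets.top[of \<mu>] by (intro finite_measureI) (simp add: emeasure_carrier)

lemma riemann_integrable_integrable:
  assumes f: "riemann_integrable X \<mu> f"
  shows "integrable (completion \<mu>) f"
proof -
  obtain B where "\<And>x. x \<in> carrier X \<Longrightarrow> norm (f x) \<le> B"
    using f by (auto simp: riemann_integrable_def bounded_iff)
  then show ?thesis
    using finite_measure.integrable_const_bound[OF finite_measure_completion AE_I2, of f B]
      riemann_integrable_measurable[OF f] by simp
qed

lemma riemann_integrable_cmod_diff:
  assumes f: "riemann_integrable X \<mu> f" and g: "riemann_integrable X \<mu> g"
  shows "riemann_integrable X \<mu> (\<lambda>x. complex_of_real (cmod (f x - g x)))"
proof (rule riemann_integrableI)
  obtain B C where "\<And>x. x \<in> carrier X \<Longrightarrow> norm (f x) \<le> B" "\<And>x. x \<in> carrier X \<Longrightarrow> norm (g x) \<le> C"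
    using f g by (auto simp: riemann_integrable_def bounded_iff)
  then have "cmod (f x - g x) \<le> B + C" if "x \<in> carrier X" for x
    using that norm_triangle_ineq4[of "f x" "g x"] by (meson add_mono order_trans)
  then show "bounded ((\<lambda>x. complex_of_real (cmod (f x - g x))) ` carrier X)"
    by (auto simp: bounded_iff)
  show "{x \<in> carrier X. \<not> topcontinuous_at T euclidean f x} \<union>
      {x \<in> carrier X. \<not> topcontinuous_at T euclidean g x} \<in> null_sets \<mu>"
    using f g by (intro null_sets.Un) (auto simp: riemann_integrable_def)
  fix x assume "x \<in> carrier X" "x \<notin> {x \<in> carrier X. \<not> topcontinuous_at T euclidean f x} \<union>
      {x \<in> carrier X. \<not> topcontinuous_at T euclidean g x}"
  then have fx: "topcontinuous_at T euclidean f x" and gx: "topcontinuous_at T euclidean g x"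
    and x: "x \<in> topspace T" by auto
  show "topcontinuous_at T euclidean (\<lambda>x. complex_of_real (cmod (f x - g x))) x"
    unfolding topcontinuous_at_dist
  proof (intro conjI allI impI x)
    fix e :: real assume "e > 0"
    then obtain U V where U: "openin T U" "x \<in> U" "\<forall>y\<in>U. dist (f y) (f x) < e / 2"
      and V: "openin T V" "x \<in> V" "\<forall>y\<in>V. dist (g y) (g x) < e / 2"
      using fx gx unfolding topcontinuous_at_dist by (meson half_gt_zero)
    have "dist (complex_of_real (cmod (f y - g y))) (complex_of_real (cmod (f x - g x))) < e"
      if "y \<in> U \<inter> V" for y
    proof -
      have "\<bar>cmod (f y - g y) - cmod (f x - g x)\<bar> \<le> cmod ((f y - g y) - (f x - g x))"
        by (rule norm_triangle_ineq3)
      also have "\<dots> \<le> dist (f y) (f x) + dist (g y) (g x)"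
        using norm_triangle_ineq4[of "f y - f x" "g y - g x"] by (simp add: dist_norm algebra_simps)
      also have "\<dots> < e" using U(3) V(3) that by fastforce
      finally show ?thesis
        by (metis dist_norm norm_of_real of_real_diff)
    qed
    then show "\<exists>U. openin T U \<and> x \<in> U \<and> (\<forall>y\<in>U.
        dist (complex_of_real (cmod (f y - g y))) (complex_of_real (cmod (f x - g x))) < e)"
      using U V by (intro exI[of _ "U \<inter> V"]) auto
  qed
qed

lemma cmod_diff_integrable:
  assumes f: "riemann_integrable X \<mu> f" and g: "riemann_integrable X \<mu> g"
  shows "integrable (completion \<mu>) (\<lambda>x. cmod (f x - g x))"
  using riemann_integrable_integrable[OF f] riemann_integrable_integrable[OF g] by auto

lemma L1_norm_eq_0_iff:
  assumes f: "riemann_integrable X \<mu> f" and g: "riemann_integrable X \<mu> g"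
  shows "L1_norm \<mu> (\<lambda>x. f x - g x) = 0 \<longleftrightarrow> (AE x in completion \<mu>. f x = g x)"
  unfolding L1_norm_def
  using cmod_diff_integrable[OF assms] by (subst integral_nonneg_eq_0_iff_AE) auto

end

section \<open>Measure preserving maps\<close>

text \<open>
  Two kinds of maps are meant: translations of a group, and the projections of the Bohr
  compactification onto other compactifications.
\<close>

locale haar_map = B: haar_group B \<mu> + X: haar_group X \<nu>
  for B :: "'b top_group" and \<mu> and X :: "'x top_group" and \<nu> +
  fixes \<pi>
  assumes cont: "continuous_map (topol B) (topol X) \<pi>" and distr: "distr \<mu> \<nu> \<pi> = \<nu>"
begin

lemma measurable: "\<pi> \<in> \<mu> \<rightarrow>\<^sub>M \<nu>"
  using cont by (rule B.continuous_map_measurable) (auto simp: X.sets_haar)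

lemma measurable_completion: "\<pi> \<in> completion \<mu> \<rightarrow>\<^sub>M completion \<nu>"
  and distr_completion: "distr (completion \<mu>) (completion \<nu>) \<pi> = completion \<nu>"
proof -
  have eq: "Measure_Space.distr (completion \<mu>) \<nu> \<pi> = \<nu>"
    using distr Complete_Measure.distr_completion[OF measurable] by simp
  have m: "\<pi> \<in> completion \<mu> \<rightarrow>\<^sub>M \<nu>" using measurable by (rule Complete_Measure.measurable_completion)
  show "\<pi> \<in> completion \<mu> \<rightarrow>\<^sub>M completion \<nu>"
    using completion.measurable_completion2[OF m] eq by simp
  show "Measure_Space.distr (completion \<mu>) (completion \<nu>) \<pi> = completion \<nu>"
    using completion.completion_distr_eq[OF m] eq by simp
qed

lemma integral_comp:
  fixes f :: "'x \<Rightarrow> 'c::{banach, second_countable_topology}"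
  assumes "f \<in> borel_measurable (completion \<nu>)"
  shows "(LINT x|completion \<mu>. f (\<pi> x)) = (LINT x|completion \<nu>. f x)"
  using integral_distr[OF measurable_completion assms] distr_completion by simp

lemma AE_comp: "AE x in completion \<nu>. P x \<Longrightarrow> AE x in completion \<mu>. P (\<pi> x)"
  using AE_distrD[OF measurable_completion, unfolded distr_completion] .

lemma in_carrier: "x \<in> carrier B \<Longrightarrow> \<pi> x \<in> carrier X"
  using cont by (auto simp: continuous_map_def)

lemma riemann_integrable_comp:
  assumes f: "riemann_integrable X \<nu> f"
  shows "riemann_integrable B \<mu> (\<lambda>x. f (\<pi> x))"
proof (rule B.riemann_integrableI)
  let ?D = "{x \<in> carrier X. \<not> topcontinuous_at (topol X) euclidean f x}"
  show "bounded ((\<lambda>x. f (\<pi> x)) ` carrier B)"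
    using f in_carrier by (auto simp: riemann_integrable_def bounded_iff)
  have "?D \<in> null_sets \<nu>" using f by (simp add: riemann_integrable_def)
  then have "?D \<in> null_sets (Measure_Space.distr \<mu> \<nu> \<pi>)" using distr by simp
  then show "\<pi> -` ?D \<inter> space \<mu> \<in> null_sets \<mu>"
    using measurable by (simp add: null_sets_distr_iff)
  fix x assume x: "x \<in> carrier B" "x \<notin> \<pi> -` ?D \<inter> space \<mu>"
  then have *: "topcontinuous_at (topol X) euclidean f (\<pi> x)" using in_carrier by auto
  show "topcontinuous_at (topol B) euclidean (\<lambda>x. f (\<pi> x)) x"
    unfolding topcontinuous_at_dist
  proof (intro conjI allI impI)
    show "x \<in> topspace (topol B)" using x by simp
    fix e :: real assume "e > 0"
    then obtain U where U: "openin (topol X) U" "\<pi> x \<in> U" "\<forall>y\<in>U. dist (f y) (f (\<pi> x)) < e"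
      using * unfolding topcontinuous_at_dist by blast
    have "openin (topol B) {b \<in> carrier B. \<pi> b \<in> U}"
      using openin_continuous_map_preimage[OF cont U(1)] by simp
    then show "\<exists>V. openin (topol B) V \<and> x \<in> V \<and> (\<forall>y\<in>V. dist (f (\<pi> y)) (f (\<pi> x)) < e)"
      using U x by (intro exI[of _ "{b \<in> carrier B. \<pi> b \<in> U}"]) auto
  qed
qed

lemma L1_norm_comp:
  assumes f: "riemann_integrable X \<nu> f" and g: "riemann_integrable X \<nu> g"
  shows "L1_norm \<mu> (\<lambda>x. f (\<pi> x) - g (\<pi> x)) = L1_norm \<nu> (\<lambda>x. f x - g x)"
  unfolding L1_norm_def
  using integral_comp[of "\<lambda>x. cmod (f x - g x)"] X.cmod_diff_integrable[OF f g] by auto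

end

section \<open>Translation in the mean\<close>

context haar_group
begin

lemma haar_map_translation: "a \<in> carrier X \<Longrightarrow> haar_map X \<mu> X \<mu> (\<lambda>y. a \<otimes> y)"
  by unfold_locales (auto simp: distr_translation translation_cont)

lemma riemann_integrable_translation:
  "riemann_integrable X \<mu> f \<Longrightarrow> a \<in> carrier X \<Longrightarrow> riemann_integrable X \<mu> (\<lambda>y. f (a \<otimes> y))"
  using haar_map.riemann_integrable_comp[OF haar_map_translation] .

text \<open>
  For a realization of \<open>\<phi>\<close> this is the extension of \<open>d\<^sub>\<phi>\<close> from the base group to the compactification;
  its zeros are the periods in the mean, and aperiodicity leaves only the unit among them.
\<close>

definition L1_shift :: "('x \<Rightarrow> complex) \<Rightarrow> 'x \<Rightarrow> real" where
  "L1_shift f x = L1_norm \<mu> (\<lambda>y. f y - f (x \<otimes> y))"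

lemma L1_shift_nonneg: "L1_shift f x \<ge> 0"
  by (simp add: L1_shift_def L1_norm_def)

lemma L1_norm_cong:
  "(\<And>y. y \<in> carrier X \<Longrightarrow> cmod (f y) = cmod (g y)) \<Longrightarrow> L1_norm \<mu> f = L1_norm \<mu> g"
  unfolding L1_norm_def by (intro Bochner_Integration.integral_cong) auto

lemma L1_shift_one: "L1_shift f \<one> = 0"
  using L1_norm_cong[of "\<lambda>y. f y - f (\<one> \<otimes> y)" "\<lambda>_. 0"] by (simp add: L1_shift_def L1_norm_def)

lemma L1_norm_triangle:
  assumes f: "riemann_integrable X \<mu> f" and g: "riemann_integrable X \<mu> g" and h: "riemann_integrable X \<mu> h"
  shows "L1_norm \<mu> (\<lambda>y. f y - h y) \<le> L1_norm \<mu> (\<lambda>y. f y - g y) + L1_norm \<mu> (\<lambda>y. g y - h y)"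
proof -
  have "L1_norm \<mu> (\<lambda>y. f y - h y) \<le> (LINT y|completion \<mu>. cmod (f y - g y) + cmod (g y - h y))"
    unfolding L1_norm_def
    using cmod_diff_integrable[OF f h] cmod_diff_integrable[OF f g] cmod_diff_integrable[OF g h]
      norm_triangle_ineq[of "f y - g y" "g y - h y" for y]
    by (intro integral_mono) auto
  also have "\<dots> = L1_norm \<mu> (\<lambda>y. f y - g y) + L1_norm \<mu> (\<lambda>y. g y - h y)"
    unfolding L1_norm_def
    using cmod_diff_integrable[OF f g] cmod_diff_integrable[OF g h] by simp
  finally show ?thesis .
qed

lemma L1_shift_translate:
  assumes f: "riemann_integrable X \<mu> f" and x: "x \<in> carrier X" and y: "y \<in> carrier X"
  shows "L1_norm \<mu> (\<lambda>z. f (y \<otimes> z) - f (x \<otimes> (y \<otimes> z))) = L1_shift f x"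
  unfolding L1_shift_def
  using haar_map.L1_norm_comp[OF haar_map_translation[OF y] f riemann_integrable_translation[OF f x]] .

text \<open>
  Subadditivity is the triangle inequality through the intermediate translate by \<open>y\<close>, together with
  invariance of the measure. Hence \<open>L1_shift f\<close> is a seminorm on the group, its zeros form a
  subgroup, and its continuity reduces to continuity at \<open>\<one>\<close>.
\<close>

lemma L1_shift_mult:
  assumes f: "riemann_integrable X \<mu> f" and x: "x \<in> carrier X" and y: "y \<in> carrier X"
  shows "L1_shift f (x \<otimes> y) \<le> L1_shift f x + L1_shift f y"
proof -
  note ri = riemann_integrable_translation[OF f]
  have "L1_shift f (x \<otimes> y) \<le>
      L1_shift f y + L1_norm \<mu> (\<lambda>z. f (y \<otimes> z) - f (x \<otimes> y \<otimes> z))"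
    unfolding L1_shift_def using f ri x y by (intro L1_norm_triangle) auto
  also have "L1_norm \<mu> (\<lambda>z. f (y \<otimes> z) - f (x \<otimes> y \<otimes> z)) = L1_norm \<mu> (\<lambda>z. f (y \<otimes> z) - f (x \<otimes> (y \<otimes> z)))"
    using x y by (intro L1_norm_cong) (simp add: m_assoc)
  also have "\<dots> = L1_shift f x" using L1_shift_translate[OF f x y] .
  finally show ?thesis by simp
qed

lemma L1_shift_inv:
  assumes f: "riemann_integrable X \<mu> f" and x: "x \<in> carrier X"
  shows "L1_shift f (inv x) = L1_shift f x"
proof -
  have "L1_shift f (inv x) = L1_norm \<mu> (\<lambda>z. f (x \<otimes> z) - f (inv x \<otimes> (x \<otimes> z)))"
    using L1_shift_translate[OF f, of "inv x" x] x by simp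
  also have "\<dots> = L1_shift f x"
    unfolding L1_shift_def using x
    by (intro L1_norm_cong) (simp add: m_assoc[symmetric] norm_minus_commute)
  finally show ?thesis .
qed

text \<open>
  Enclose the discontinuities in an open set \<open>U\<close> of small measure. Off \<open>U\<close>, translation by elements
  near \<open>\<one>\<close> changes \<open>f\<close> uniformly little; on \<open>U\<close> the crude bound \<open>2 M\<close> suffices.
\<close>

lemma L1_shift_small:
  assumes f: "riemann_integrable X \<mu> f" and "\<epsilon> > 0"
  obtains V where "openin T V" "\<one> \<in> V" "\<And>v. v \<in> V \<Longrightarrow> L1_shift f v < \<epsilon>"
proof -
  define D where "D = {x \<in> carrier X. \<not> topcontinuous_at T euclidean f x}"
  have D: "D \<in> null_sets \<mu>" using f by (simp add: riemann_integrable_def D_def)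
  obtain M where M: "\<And>x. x \<in> carrier X \<Longrightarrow> cmod (f x) \<le> M"
    using f by (auto simp: riemann_integrable_def bounded_iff)
  have "M \<ge> 0" using M[OF one_closed] norm_ge_zero[of "f \<one>"] by linarith
  \<comment> \<open>Chosen to make \<open>2 M \<delta> < \<epsilon> / 2\<close>, also when \<open>M = 0\<close>.\<close>
  define \<delta> where "\<delta> = \<epsilon> / (4 * (M + 1))"
  have "\<delta> > 0" using \<open>\<epsilon> > 0\<close> \<open>M \<ge> 0\<close> by (simp add: \<delta>_def)
  have "(INF U\<in>{U. openin T U \<and> D \<subseteq> U}. emeasure \<mu> U) = 0"
    using haar_outer[OF null_setsD2[OF D], symmetric] null_setsD1[OF D] by (rule trans)
  also have "0 < ennreal \<delta>" using \<open>\<delta> > 0\<close> by simp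
  finally obtain U where U: "openin T U" "D \<subseteq> U" "emeasure \<mu> U < ennreal \<delta>"
    unfolding INF_less_iff by auto
  then have U\<delta>: "measure \<mu> U < \<delta>"
    using \<open>\<delta> > 0\<close> by (simp add: emeasure_eq_measure ennreal_less_iff)
  have "compactin T (carrier X - U)"
    using closedin_compact_space[OF compact closed_complement[OF U(1)]] .
  moreover have "topcontinuous_at T euclidean f x" if "x \<in> carrier X - U" for x
    using that U(2) by (auto simp: D_def)
  moreover have "\<epsilon> / 2 > 0" using \<open>\<epsilon> > 0\<close> by simp
  ultimately obtain V where V: "openin T V" "\<one> \<in> V"
    "\<And>v y. v \<in> V \<Longrightarrow> y \<in> carrier X - U \<Longrightarrow> dist (f y) (f (v \<otimes> y)) < \<epsilon> / 2"
    using uniform_nbhd[of "carrier X - U" f "\<epsilon> / 2"] by metis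
  show thesis
  proof (rule that[OF V(1,2)])
    fix v assume v: "v \<in> V"
    then have vc: "v \<in> carrier X" using openin_carrier[OF V(1)] by blast
    interpret c: finite_measure "completion \<mu>" by (rule finite_measure_completion)
    have intU: "integrable (completion \<mu>) (indicat_real U)"
      using sets_open[OF U(1)] by (intro integrable_real_indicator) (auto simp: less_top[symmetric])
    have "L1_shift f v \<le> (LINT y|completion \<mu>. \<epsilon> / 2 + 2 * M * indicator U y)"
      unfolding L1_shift_def L1_norm_def
    proof (intro integral_mono)
      show "integrable (completion \<mu>) (\<lambda>y. cmod (f y - f (v \<otimes> y)))"
        using cmod_diff_integrable[OF f riemann_integrable_translation[OF f vc]] .
      show "integrable (completion \<mu>) (\<lambda>y. \<epsilon> / 2 + 2 * M * indicator U y)"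
        using intU by simp
      fix y assume "y \<in> space (completion \<mu>)"
      then have y: "y \<in> carrier X" by simp
      show "cmod (f y - f (v \<otimes> y)) \<le> \<epsilon> / 2 + 2 * M * indicator U y"
      proof (cases "y \<in> U")
        case True
        then show ?thesis
          using M[OF y] M[of "v \<otimes> y"] y vc norm_triangle_ineq4[of "f y" "f (v \<otimes> y)"] \<open>\<epsilon> > 0\<close> by simp
      next
        case False
        then show ?thesis using V(3)[OF v, of y] y by (simp add: dist_norm)
      qed
    qed
    also have "\<dots> = \<epsilon> / 2 * measure \<mu> (carrier X) + 2 * M * measure \<mu> U"
    proof -
      have "U \<inter> carrier X = U" using openin_carrier[OF U(1)] by blast
      then show ?thesis using intU sets_open[OF U(1)] sets.top[of \<mu>] by simp
    qed
    also have "\<dots> \<le> \<epsilon> / 2 + 2 * M * \<delta>"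
      using emeasure_carrier U\<delta> \<open>M \<ge> 0\<close> by (simp add: measure_def mult_left_mono)
    also have "\<dots> < \<epsilon>"
    proof -
      have "2 * M * \<delta> = \<epsilon> / 2 * (M / (M + 1))" using \<open>M \<ge> 0\<close> by (simp add: \<delta>_def field_simps)
      also have "\<dots> < \<epsilon> / 2 * 1" using \<open>\<epsilon> > 0\<close> \<open>M \<ge> 0\<close> by (intro mult_strict_left_mono) auto
      finally show ?thesis by simp
    qed
    finally show "L1_shift f v < \<epsilon>" .
  qed
qed

lemma L1_shift_continuous:
  assumes f: "riemann_integrable X \<mu> f"
  shows "continuous_map T euclideanreal (L1_shift f)"
  unfolding continuous_map_eq_topcontinuous_at
proof
  fix x assume "x \<in> topspace T"
  then have x: "x \<in> carrier X" by simp
  show "topcontinuous_at T euclideanreal (L1_shift f) x"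
    unfolding topcontinuous_at_dist
  proof (intro conjI allI impI)
    show "x \<in> topspace T" using x by simp
    fix e :: real assume "e > 0"
    then obtain V where V: "openin T V" "\<one> \<in> V" "\<And>v. v \<in> V \<Longrightarrow> L1_shift f v < e"
      using L1_shift_small[OF f] by blast
    have "dist (L1_shift f (x \<otimes> v)) (L1_shift f x) < e" if v: "v \<in> V" for v
    proof -
      have vc: "v \<in> carrier X" using v V(1) openin_carrier by blast
      have "(x \<otimes> v) \<otimes> inv v = x" using x vc by (simp add: m_assoc)
      then have "L1_shift f x \<le> L1_shift f (x \<otimes> v) + L1_shift f v"
        using L1_shift_mult[OF f, of "x \<otimes> v" "inv v"] L1_shift_inv[OF f vc] x vc by simp
      moreover have "L1_shift f (x \<otimes> v) \<le> L1_shift f x + L1_shift f v"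
        using L1_shift_mult[OF f x vc] .
      ultimately show ?thesis using V(3)[OF v] by (simp add: dist_real_def)
    qed
    moreover have "x \<in> (\<lambda>v. x \<otimes> v) ` V" using x V(2) by (metis imageI r_one)
    ultimately show "\<exists>U. openin T U \<and> x \<in> U \<and> (\<forall>y\<in>U. dist (L1_shift f y) (L1_shift f x) < e)"
      using open_translation[OF V(1) x] by (intro exI[of _ "(\<lambda>v. x \<otimes> v) ` V"]) auto
  qed
qed

lemma L1_shift_cong_AE:
  assumes f: "riemann_integrable X \<mu> f" and g: "riemann_integrable X \<mu> g"
    and eq: "AE x in completion \<mu>. f x = g x" and x: "x \<in> carrier X"
  shows "L1_shift f x = L1_shift g x"
proof -
  have "AE y in completion \<mu>. f (x \<otimes> y) = g (x \<otimes> y)"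
    using haar_map.AE_comp[OF haar_map_translation[OF x] eq] .
  then have "AE y in completion \<mu>. cmod (f y - f (x \<otimes> y)) = cmod (g y - g (x \<otimes> y))"
    using eq by eventually_elim simp
  then show ?thesis
    unfolding L1_shift_def L1_norm_def
    using cmod_diff_integrable[OF f riemann_integrable_translation[OF f x]]
      cmod_diff_integrable[OF g riemann_integrable_translation[OF g x]]
    by (intro integral_cong_AE) auto
qed

text \<open>
  \<open>|f - g|\<close> is again continuous almost everywhere, and where it is continuous it vanishes by
  density. This is what makes integrals of realizations depend only on their restriction to the
  dense image of the base group.
\<close>

lemma riemann_integrable_eq_AE:
  assumes f: "riemann_integrable X \<mu> f" and g: "riemann_integrable X \<mu> g"
    and E: "T closure_of E = carrier X" and eq: "\<And>x. x \<in> E \<Longrightarrow> f x = g x"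
  shows "AE x in completion \<mu>. f x = g x"
proof -
  let ?h = "\<lambda>x. complex_of_real (cmod (f x - g x))"
  let ?D = "{x \<in> carrier X. \<not> topcontinuous_at T euclidean ?h x}"
  have "?D \<in> null_sets \<mu>"
    using riemann_integrable_cmod_diff[OF f g] by (simp add: riemann_integrable_def)
  moreover have "f x = g x" if x: "x \<in> space \<mu> - ?D" for x
  proof (rule ccontr)
    assume "f x \<noteq> g x"
    then have "cmod (f x - g x) > 0" by simp
    moreover have "topcontinuous_at T euclidean ?h x" using x by simp
    ultimately obtain U where U: "openin T U" "x \<in> U" "\<forall>y\<in>U. dist (?h y) (?h x) < cmod (f x - g x)"
      unfolding topcontinuous_at_dist by blast
    have "x \<in> T closure_of E" using x E by simp
    then obtain y where "y \<in> E" "y \<in> U" using U unfolding in_closure_of by blast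
    then show False using U(3) eq[of y] by (auto simp: dist_norm)
  qed
  ultimately have "AE x in \<mu>. f x = g x" by (intro AE_I'[of ?D]) blast+
  then show ?thesis by (rule AE_completion)
qed

end

lemma (in haar_map) L1_shift_comp:
  assumes hom: "\<pi> \<in> hom B X" and f: "riemann_integrable X \<nu> f" and b: "b \<in> carrier B"
  shows "B.L1_shift (\<lambda>x. f (\<pi> x)) b = X.L1_shift f (\<pi> b)"
proof -
  have "B.L1_shift (\<lambda>x. f (\<pi> x)) b = L1_norm \<mu> (\<lambda>x. f (\<pi> x) - f (\<pi> b \<otimes>\<^bsub>X\<^esub> \<pi> x))"
    unfolding B.L1_shift_def using hom b by (intro B.L1_norm_cong) (simp add: hom_def)
  also have "\<dots> = X.L1_shift f (\<pi> b)"
    unfolding X.L1_shift_def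
    by (intro L1_norm_comp f X.riemann_integrable_translation in_carrier b)
  finally show ?thesis .
qed

lemma (in haar_group) period_subgroup:
  assumes f: "riemann_integrable X \<mu> f"
  shows "subgroup {x \<in> carrier X. L1_shift f x = 0} X"
    and "closedin T {x \<in> carrier X. L1_shift f x = 0}"
proof -
  show "subgroup {x \<in> carrier X. L1_shift f x = 0} X"
  proof (rule subgroupI)
    show "{x \<in> carrier X. L1_shift f x = 0} \<noteq> {}" using L1_shift_one by blast
    fix a b assume "a \<in> {x \<in> carrier X. L1_shift f x = 0}" "b \<in> {x \<in> carrier X. L1_shift f x = 0}"
    then show "a \<otimes> b \<in> {x \<in> carrier X. L1_shift f x = 0}"
      using L1_shift_mult[OF f, of a b] L1_shift_nonneg[of f "a \<otimes> b"] by simp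
  qed (auto simp: L1_shift_inv[OF f])
  have "closedin T {x \<in> topspace T. L1_shift f x \<in> {0}}"
    by (rule closedin_continuous_map_preimage[OF L1_shift_continuous[OF f]]) simp
  then show "closedin T {x \<in> carrier X. L1_shift f x = 0}" by simp
qed

section \<open>Quotients by closed subgroups\<close>

text \<open>
  The quotient of \<open>X\<close> by the fibres of \<open>r\<close>, carried by the values of \<open>r\<close> in place of cosets. The choice of
  \<open>r\<close> decides the type of the carrier: an injective \<open>r\<close> transports \<open>X\<close> to another type, and a map \<open>r\<close>
  selecting representatives keeps the quotient inside the type of \<open>X\<close>.
\<close>

definition image_group :: "'x top_group \<Rightarrow> ('x \<Rightarrow> 'y) \<Rightarrow> 'y top_group" where
  "image_group X r =
     \<lparr>carrier = r ` carrier X,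
      mult = (\<lambda>a b. r (inv_into (carrier X) r a \<otimes>\<^bsub>X\<^esub> inv_into (carrier X) r b)),
      one = r \<one>\<^bsub>X\<^esub>,
      topol = topology (\<lambda>U. U \<subseteq> r ` carrier X \<and> openin (topol X) {x \<in> carrier X. r x \<in> U})\<rparr>"

locale closed_quotient = compact_ab_group X for X :: "'x top_group" (structure) +
  fixes r :: "'x \<Rightarrow> 'y" and N
  assumes N: "subgroup N X" and N_closed: "closedin T N"
    and fibre: "\<And>x y. x \<in> carrier X \<Longrightarrow> y \<in> carrier X \<Longrightarrow> r x = r y \<longleftrightarrow> x \<otimes> inv y \<in> N"
begin

abbreviation "Q \<equiv> image_group X r"

lemma carrier_Q [simp]: "carrier Q = r ` carrier X"
  and one_Q: "\<one>\<^bsub>Q\<^esub> = r \<one>"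
  by (simp_all add: image_group_def)

lemma openin_Q: "openin (topol Q) U \<longleftrightarrow> U \<subseteq> r ` carrier X \<and> openin T {x \<in> carrier X. r x \<in> U}"
proof -
  have "istopology (\<lambda>U. U \<subseteq> r ` carrier X \<and> openin T {x \<in> carrier X. r x \<in> U})"
    unfolding istopology_def
  proof (intro conjI allI impI)
    fix S U
    assume "S \<subseteq> r ` carrier X \<and> openin T {x \<in> carrier X. r x \<in> S}"
      "U \<subseteq> r ` carrier X \<and> openin T {x \<in> carrier X. r x \<in> U}"
    moreover have "{x \<in> carrier X. r x \<in> S \<inter> U} = {x \<in> carrier X. r x \<in> S} \<inter> {x \<in> carrier X. r x \<in> U}" by auto
    ultimately show "openin T {x \<in> carrier X. r x \<in> S \<inter> U}" "S \<inter> U \<subseteq> r ` carrier X" by auto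
  next
    fix \<K> assume *: "\<forall>K\<in>\<K>. K \<subseteq> r ` carrier X \<and> openin T {x \<in> carrier X. r x \<in> K}"
    then show "\<Union>\<K> \<subseteq> r ` carrier X" by blast
    have "openin T (\<Union>K\<in>\<K>. {x \<in> carrier X. r x \<in> K})" using * by (intro openin_Union) auto
    moreover have "(\<Union>K\<in>\<K>. {x \<in> carrier X. r x \<in> K}) = {x \<in> carrier X. r x \<in> \<Union>\<K>}" by auto
    ultimately show "openin T {x \<in> carrier X. r x \<in> \<Union>\<K>}" by simp
  qed
  then show ?thesis by (simp add: image_group_def)
qed

lemma topspace_Q [simp]: "topspace (topol Q) = r ` carrier X"
proof
  show "topspace (topol Q) \<subseteq> r ` carrier X" using openin_Q openin_topspace by blast
  have "{x \<in> carrier X. r x \<in> r ` carrier X} = topspace T" by auto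
  then have "openin (topol Q) (r ` carrier X)"
    unfolding openin_Q by (metis openin_topspace subset_refl)
  then show "r ` carrier X \<subseteq> topspace (topol Q)" by (rule openin_subset)
qed

lemma mult_Q:
  assumes x: "x \<in> carrier X" and y: "y \<in> carrier X"
  shows "r x \<otimes>\<^bsub>Q\<^esub> r y = r (x \<otimes> y)"
proof -
  interpret N: subgroup N X by (rule N)
  have rep: "\<exists>n\<in>N. inv_into (carrier X) r (r z) = n \<otimes> z" if z: "z \<in> carrier X" for z
  proof -
    let ?z = "inv_into (carrier X) r (r z)"
    have z': "?z \<in> carrier X" "r ?z = r z" using z by (auto intro: inv_into_into f_inv_into_f)
    then have "?z \<otimes> inv z \<in> N" using fibre z by blast
    moreover have "?z = (?z \<otimes> inv z) \<otimes> z" using z z'(1) by (simp add: m_assoc)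
    ultimately show ?thesis by blast
  qed
  obtain n m where n: "n \<in> N" "inv_into (carrier X) r (r x) = n \<otimes> x"
    and m: "m \<in> N" "inv_into (carrier X) r (r y) = m \<otimes> y"
    using rep[OF x] rep[OF y] by blast
  have nm: "n \<in> carrier X" "m \<in> carrier X" using n m by auto
  have "((n \<otimes> x) \<otimes> (m \<otimes> y)) = (n \<otimes> m) \<otimes> (x \<otimes> y)" using nm x y by (simp add: m_ac)
  then have "((n \<otimes> x) \<otimes> (m \<otimes> y)) \<otimes> inv (x \<otimes> y) = n \<otimes> m" using nm x y by (simp add: m_assoc)
  then have "r ((n \<otimes> x) \<otimes> (m \<otimes> y)) = r (x \<otimes> y)"
    using n m nm x y by (subst fibre) auto
  then show ?thesis using n m by (simp add: image_group_def)
qed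

lemma comm_group_Q: "comm_group Q"
proof (rule comm_groupI)
  fix a assume "a \<in> carrier Q"
  then obtain x where "x \<in> carrier X" "a = r x" by auto
  then show "\<exists>b\<in>carrier Q. b \<otimes>\<^bsub>Q\<^esub> a = \<one>\<^bsub>Q\<^esub>"
    by (intro bexI[of _ "r (inv x)"]) (auto simp: mult_Q one_Q)
qed (auto simp: mult_Q one_Q m_ac)

lemma hom_Q: "r \<in> hom X Q"
  by (auto simp: hom_def mult_Q)

lemma inv_Q: "x \<in> carrier X \<Longrightarrow> inv\<^bsub>Q\<^esub> (r x) = r (inv x)"
proof -
  interpret Q: comm_group Q by (rule comm_group_Q)
  interpret group_hom X Q r by unfold_locales (rule hom_Q)
  show "x \<in> carrier X \<Longrightarrow> inv\<^bsub>Q\<^esub> (r x) = r (inv x)" by simp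
qed

lemma cont_Q: "continuous_map T (topol Q) r"
  by (auto simp: continuous_map_def openin_Q)

text \<open>
  The saturation of an open set is a union of translates of it.
\<close>

lemma open_map_Q: "open_map T (topol Q) r"
  unfolding open_map_def
proof (intro allI impI)
  interpret N: subgroup N X by (rule N)
  fix U assume U: "openin T U"
  have "{x \<in> carrier X. r x \<in> r ` U} = (\<Union>n\<in>N. (\<lambda>y. n \<otimes> y) ` U)"
  proof (intro equalityI subsetI)
    fix x assume "x \<in> {x \<in> carrier X. r x \<in> r ` U}"
    then obtain u where u: "u \<in> U" "r x = r u" "x \<in> carrier X" by auto
    then have uc: "u \<in> carrier X" using openin_carrier[OF U] by blast
    have "x \<otimes> inv u \<in> N" using fibre[of x u] u uc by simp
    moreover have "x = (x \<otimes> inv u) \<otimes> u" using u uc by (simp add: m_assoc)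
    ultimately show "x \<in> (\<Union>n\<in>N. (\<lambda>y. n \<otimes> y) ` U)" using u(1) by blast
  next
    fix x assume "x \<in> (\<Union>n\<in>N. (\<lambda>y. n \<otimes> y) ` U)"
    then obtain n u where nu: "n \<in> N" "u \<in> U" "x = n \<otimes> u" by blast
    then have c: "n \<in> carrier X" "u \<in> carrier X" using openin_carrier[OF U] by auto
    have "x \<otimes> inv u = n" using c nu(3) by (simp add: m_assoc)
    then have "r x = r u" using fibre[of x u] nu c by simp
    then show "x \<in> {x \<in> carrier X. r x \<in> r ` U}" using nu c by auto
  qed
  moreover have "openin T (\<Union>n\<in>N. (\<lambda>y. n \<otimes> y) ` U)"
    using open_translation[OF U] N.mem_carrier by (intro openin_Union) auto
  ultimately show "openin (topol Q) (r ` U)"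
    using openin_carrier[OF U] by (auto simp: openin_Q)
qed

text \<open>
  If \<open>x\<close> and \<open>y\<close> lie in different cosets then \<open>x \<otimes> inv y\<close> lies in the open complement of \<open>N\<close>, and so do
  all nearby quotients; as \<open>r\<close> is open, the images of these neighborhoods are open and disjoint.
\<close>

lemma hausdorff_Q: "Hausdorff_space (topol Q)"
  unfolding Hausdorff_space_def
proof (intro allI impI, elim conjE)
  fix a b assume "a \<in> topspace (topol Q)" "b \<in> topspace (topol Q)" "a \<noteq> b"
  then obtain x y where xy: "x \<in> carrier X" "y \<in> carrier X" "a = r x" "b = r y" by auto
  then have "x \<otimes> inv y \<in> carrier X - N" using \<open>a \<noteq> b\<close> fibre[of x y] by auto
  moreover have "openin T (carrier X - N)" using N_closed by (simp add: closedin_def)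
  ultimately obtain U V where UV: "openin T U" "openin T V" "x \<in> U" "inv y \<in> V"
    "\<And>u v. u \<in> U \<Longrightarrow> v \<in> V \<Longrightarrow> u \<otimes> v \<in> carrier X - N"
    using mult_nbhds[of "carrier X - N" x "inv y"] xy by (metis inv_closed)
  define V' where "V' = {z \<in> carrier X. inv z \<in> V}"
  have V': "openin T V'" using openin_continuous_map_preimage[OF inv_cont UV(2)] by (simp add: V'_def)
  have "disjnt (r ` U) (r ` V')"
    unfolding disjnt_iff
  proof (intro allI notI, elim conjE imageE)
    fix c u v assume u: "u \<in> U" and v: "v \<in> V'" "c = r u" "c = r v"
    then have "u \<otimes> inv v \<in> N"
      using fibre[of u v] openin_carrier[OF UV(1)] by (auto simp: V'_def)
    then show False using UV(5)[OF u, of "inv v"] v(1) by (auto simp: V'_def)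
  qed
  moreover have "y \<in> V'" using xy UV by (simp add: V'_def)
  ultimately show "\<exists>U V. openin (topol Q) U \<and> openin (topol Q) V \<and> a \<in> U \<and> b \<in> V \<and> disjnt U V"
    using open_map_Q UV(1,3) V' xy unfolding open_map_def by blast
qed

lemma compact_group_Q: "compact_group Q"
  unfolding compact_group_def
proof (intro conjI)
  interpret Q: comm_group Q by (rule comm_group_Q)
  show "group Q" by (rule Q.is_group)
  show "topspace (topol Q) = carrier Q" by simp
  show "compact_space (topol Q)"
    using image_compactin[OF _ cont_Q, of "carrier X"] compact by (simp add: compact_space_def)
  show "Hausdorff_space (topol Q)" by (rule hausdorff_Q)
  show "continuous_map (topol Q) (topol Q) (\<lambda>x. inv\<^bsub>Q\<^esub> x)"
    unfolding continuous_map_def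
  proof (intro conjI allI impI)
    show "(\<lambda>x. inv\<^bsub>Q\<^esub> x) \<in> topspace (topol Q) \<rightarrow> topspace (topol Q)" by (auto simp: inv_Q)
    fix U assume "openin (topol Q) U"
    then have "openin T {x \<in> carrier X. inv x \<in> {x \<in> carrier X. r x \<in> U}}"
      using openin_continuous_map_preimage[OF inv_cont, of "{x \<in> carrier X. r x \<in> U}"]
      by (simp add: openin_Q)
    moreover have "{x \<in> carrier X. inv x \<in> {x \<in> carrier X. r x \<in> U}} =
        {x \<in> carrier X. r x \<in> {x \<in> topspace (topol Q). inv\<^bsub>Q\<^esub> x \<in> U}}"
      using inv_Q by (intro Collect_cong conj_cong refl) (simp del: image_iff)
    ultimately show "openin (topol Q) {x \<in> topspace (topol Q). inv\<^bsub>Q\<^esub> x \<in> U}"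
      unfolding openin_Q by auto
  qed
  show "continuous_map (prod_topology (topol Q) (topol Q)) (topol Q) (\<lambda>(x, y). x \<otimes>\<^bsub>Q\<^esub> y)"
    unfolding continuous_map_def
  proof (intro conjI allI impI)
    show "(\<lambda>(x, y). x \<otimes>\<^bsub>Q\<^esub> y) \<in> topspace (prod_topology (topol Q) (topol Q)) \<rightarrow> topspace (topol Q)"
      by (auto simp: mult_Q)
    fix W assume W: "openin (topol Q) W"
    show "openin (prod_topology (topol Q) (topol Q))
        {p \<in> topspace (prod_topology (topol Q) (topol Q)). (case p of (x, y) \<Rightarrow> x \<otimes>\<^bsub>Q\<^esub> y) \<in> W}"
      unfolding openin_prod_topology_alt
    proof (intro allI impI)
      fix a b
      assume "(a, b) \<in> {p \<in> topspace (prod_topology (topol Q) (topol Q)). (case p of (x, y) \<Rightarrow> x \<otimes>\<^bsub>Q\<^esub> y) \<in> W}"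
      then obtain x y where xy: "x \<in> carrier X" "y \<in> carrier X" "a = r x" "b = r y" "r (x \<otimes> y) \<in> W"
        by (auto simp: mult_Q)
      then have "openin T {x \<in> carrier X. r x \<in> W}" "x \<otimes> y \<in> {x \<in> carrier X. r x \<in> W}"
        using W by (auto simp: openin_Q)
      then obtain U V where UV: "openin T U" "openin T V" "x \<in> U" "y \<in> V"
        "\<And>u v. u \<in> U \<Longrightarrow> v \<in> V \<Longrightarrow> u \<otimes> v \<in> {x \<in> carrier X. r x \<in> W}"
        using mult_nbhds[of "{x \<in> carrier X. r x \<in> W}" x y] xy(1,2) by blast
      have "r ` U \<times> r ` V \<subseteq> {p \<in> topspace (prod_topology (topol Q) (topol Q)). (case p of (x, y) \<Rightarrow> x \<otimes>\<^bsub>Q\<^esub> y) \<in> W}"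
        using UV(5) openin_carrier[OF UV(1)] openin_carrier[OF UV(2)] by (auto simp: mult_Q subset_iff)
      then show "\<exists>U V. openin (topol Q) U \<and> openin (topol Q) V \<and> a \<in> U \<and> b \<in> V \<and>
          U \<times> V \<subseteq> {p \<in> topspace (prod_topology (topol Q) (topol Q)). (case p of (x, y) \<Rightarrow> x \<otimes>\<^bsub>Q\<^esub> y) \<in> W}"
        using open_map_Q UV xy unfolding open_map_def by blast
    qed
  qed
qed

lemma compact_ab_group_Q: "compact_ab_group Q"
  using comm_group_Q compact_group_Q by (simp add: compact_ab_group_def compact_ab_group_axioms_def)

lemma group_compactification_Q:
  assumes "group_compactification X \<iota>"
  shows "group_compactification Q (r \<circ> \<iota>)"
proof -
  have \<iota>: "\<iota> \<in> hom \<lparr>carrier = UNIV, mult = (+), one = 0\<rparr> X" "continuous_map euclidean T \<iota>"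
    "T closure_of range \<iota> = carrier X"
    using assms by (auto simp: group_compactification_def)
  have "r ` carrier X \<subseteq> topol Q closure_of (r ` range \<iota>)"
    using continuous_map_image_closure_subset[OF cont_Q, of "range \<iota>"] \<iota>(3) by simp
  moreover have "topol Q closure_of (r ` range \<iota>) \<subseteq> r ` carrier X"
    using closure_of_subset_topspace[of "topol Q"] by simp
  moreover have "r \<circ> \<iota> \<in> hom \<lparr>carrier = UNIV, mult = (+), one = 0\<rparr> Q"
    using \<iota>(1) by (auto simp: hom_def mult_Q Pi_iff)
  ultimately show ?thesis
    using compact_group_Q continuous_map_compose[OF \<iota>(2) cont_Q]
    by (auto simp: group_compactification_def image_comp)
qed

end

section \<open>Group compactifications\<close>

text \<open>
  Commutation is a closed condition in a Hausdorff group, and it holds on the dense image of the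
  abelian base group; density is used once for each of the two variables.
\<close>

lemma compactification_comm:
  assumes "group_compactification X (\<iota> :: 'g::topological_ab_group_add \<Rightarrow> 'x)"
  shows "compact_ab_group X"
proof -
  have cg: "compact_group X" and \<iota>: "\<iota> \<in> hom \<lparr>carrier = UNIV, mult = (+), one = 0\<rparr> X"
    and dense: "topol X closure_of range \<iota> = carrier X"
    using assms by (auto simp: group_compactification_def)
  then have ts: "topspace (topol X) = carrier X"
    and mult: "continuous_map (prod_topology (topol X) (topol X)) (topol X) (\<lambda>(x, y). x \<otimes>\<^bsub>X\<^esub> y)"
    and haus: "Hausdorff_space (topol X)" and X: "group X"
    by (auto simp: compact_group_def)
  interpret X: group X by (rule X)
  have \<iota>c: "\<iota> g \<in> carrier X" for g using \<iota> by (auto simp: hom_def)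
  have \<iota>_add: "\<iota> g \<otimes>\<^bsub>X\<^esub> \<iota> h = \<iota> (g + h)" for g h using \<iota> by (auto simp: hom_def)
  have trans: "x \<otimes>\<^bsub>X\<^esub> y = y \<otimes>\<^bsub>X\<^esub> x"
    if x: "x \<in> carrier X" and comm: "\<And>g. x \<otimes>\<^bsub>X\<^esub> \<iota> g = \<iota> g \<otimes>\<^bsub>X\<^esub> x" and y: "y \<in> carrier X" for x y
  proof -
    have l: "continuous_map (topol X) (topol X) (\<lambda>y. x \<otimes>\<^bsub>X\<^esub> y)"
      using continuous_map_compose[OF _ mult, of "topol X" "\<lambda>y. (x, y)"] x ts
      by (simp add: o_def continuous_map_pairedI)
    have r: "continuous_map (topol X) (topol X) (\<lambda>y. y \<otimes>\<^bsub>X\<^esub> x)"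
      using continuous_map_compose[OF _ mult, of "topol X" "\<lambda>y. (y, x)"] x ts
      by (simp add: o_def continuous_map_pairedI)
    have "topol X closure_of range \<iota> \<subseteq> {y \<in> topspace (topol X). x \<otimes>\<^bsub>X\<^esub> y = y \<otimes>\<^bsub>X\<^esub> x}"
      using comm \<iota>c ts closedin_continuous_maps_eq[OF haus l r] by (intro closure_of_minimal) auto
    then show ?thesis using y dense by blast
  qed
  have "\<iota> g \<otimes>\<^bsub>X\<^esub> y = y \<otimes>\<^bsub>X\<^esub> \<iota> g" if "y \<in> carrier X" for g y
    using trans[OF \<iota>c _ that] by (simp add: \<iota>_add add.commute)
  then have "x \<otimes>\<^bsub>X\<^esub> y = y \<otimes>\<^bsub>X\<^esub> x" if "x \<in> carrier X" "y \<in> carrier X" for x y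
    using trans[of x y] that by metis
  then have "comm_group X" by (rule X.group_comm_groupI)
  then show ?thesis using cg by (simp add: compact_ab_group_def compact_ab_group_axioms_def)
qed

text \<open>
  Maximality of \<open>B\<close> speaks of compactifications with carrier type \<open>'g set set\<close>. Trace filters, being
  injective on the carrier, transport \<open>X\<close> to that type; composing the resulting map with the inverse
  of the transport gives maximality with respect to compactifications of any carrier type.
  Surjectivity holds because the image is compact, hence closed, and dense.
\<close>

lemma bohr_universal:
  assumes B: "bohr_compactification B (\<iota>b :: 'g::topological_ab_group_add \<Rightarrow> 'b)"
    and X: "group_compactification X (\<iota> :: 'g \<Rightarrow> 'x)"
  obtains \<pi> where "\<pi> \<in> hom B X" "continuous_map (topol B) (topol X) \<pi>" "\<And>g. \<pi> (\<iota>b g) = \<iota> g"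
    "\<pi> ` carrier B = carrier X"
proof -
  interpret B: compact_ab_group B
    using B compactification_comm by (auto simp: bohr_compactification_def)
  interpret X: compact_ab_group X using X by (rule compactification_comm)
  define r where "r = trace_filter X \<iota>"
  have r: "inj_on r (carrier X)" unfolding r_def using X by (rule inj_on_trace_filter)
  interpret q: closed_quotient X r "{\<one>\<^bsub>X\<^esub>}"
  proof (intro closed_quotient.intro closed_quotient_axioms.intro X.compact_ab_group_axioms)
    show "subgroup {\<one>\<^bsub>X\<^esub>} X" by (rule X.triv_subgroup)
    show "closedin X.T {\<one>\<^bsub>X\<^esub>}"
      using X.haus Hausdorff_imp_t1_space by (simp add: closedin_Hausdorff_singleton)
    fix x y assume xy: "x \<in> carrier X" "y \<in> carrier X"
    then show "r x = r y \<longleftrightarrow> x \<otimes>\<^bsub>X\<^esub> inv\<^bsub>X\<^esub> y \<in> {\<one>\<^bsub>X\<^esub>}"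
      using r by (metis X.inv_closed X.inv_inv X.inv_equality X.r_inv inj_onD singletonD singletonI)
  qed
  have "group_compactification q.Q (r \<circ> \<iota>)" using X by (rule q.group_compactification_Q)
  then have "\<exists>\<pi>'. \<pi>' \<in> hom B q.Q \<and> continuous_map (topol B) (topol q.Q) \<pi>' \<and>
      (\<forall>g. \<pi>' (\<iota>b g) = (r \<circ> \<iota>) g)"
    using B unfolding bohr_compactification_def by blast
  then obtain \<pi>' where \<pi>': "\<pi>' \<in> hom B q.Q" "continuous_map (topol B) (topol q.Q) \<pi>'"
    "\<And>g. \<pi>' (\<iota>b g) = r (\<iota> g)"
    by auto
  define s where "s = inv_into (carrier X) r"
  have s: "s (r x) = x" if "x \<in> carrier X" for x using r that by (simp add: s_def)
  define \<pi> where "\<pi> x = s (\<pi>' x)" for x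
  have \<pi>c: "\<pi> b \<in> carrier X" "r (\<pi> b) = \<pi>' b" if b: "b \<in> carrier B" for b
  proof -
    have "\<pi>' b \<in> r ` carrier X" using \<pi>'(1) b unfolding hom_def by auto
    then obtain x where "x \<in> carrier X" "\<pi>' b = r x" by blast
    then show "\<pi> b \<in> carrier X" "r (\<pi> b) = \<pi>' b" by (simp_all add: \<pi>_def s)
  qed
  have hom: "\<pi> \<in> hom B X"
    unfolding hom_def
  proof (intro CollectI conjI ballI)
    fix a b assume ab: "a \<in> carrier B" "b \<in> carrier B"
    have "\<pi>' (a \<otimes>\<^bsub>B\<^esub> b) = r (\<pi> a) \<otimes>\<^bsub>q.Q\<^esub> r (\<pi> b)" using \<pi>'(1) ab by (simp add: hom_def \<pi>c)
    also have "\<dots> = r (\<pi> a \<otimes>\<^bsub>X\<^esub> \<pi> b)" using ab by (intro q.mult_Q \<pi>c)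
    finally show "\<pi> (a \<otimes>\<^bsub>B\<^esub> b) = \<pi> a \<otimes>\<^bsub>X\<^esub> \<pi> b" using ab by (simp add: \<pi>_def[of "a \<otimes>\<^bsub>B\<^esub> b"] s \<pi>c)
  qed (use \<pi>c in auto)
  have cont: "continuous_map (topol B) (topol X) \<pi>"
    unfolding continuous_map_def
  proof (intro conjI allI impI)
    show "\<pi> \<in> topspace B.T \<rightarrow> topspace X.T" using \<pi>c by auto
    fix U assume U: "openin X.T U"
    have "openin B.T {b \<in> carrier B. \<pi>' b \<in> r ` U}"
      using openin_continuous_map_preimage[OF \<pi>'(2)] q.open_map_Q U by (simp add: open_map_def)
    also have "{b \<in> carrier B. \<pi>' b \<in> r ` U} = {b \<in> topspace B.T. \<pi> b \<in> U}"
      using X.openin_carrier[OF U] \<pi>c s by (auto simp: \<pi>_def subset_iff) (metis \<pi>_def \<pi>c(2) imageI)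
    finally show "openin B.T {b \<in> topspace B.T. \<pi> b \<in> U}" .
  qed
  have \<iota>c: "\<iota> g \<in> carrier X" and \<iota>bc: "\<iota>b g \<in> carrier B" for g
    using X B by (auto simp: group_compactification_def bohr_compactification_def hom_def)
  have comm: "\<pi> (\<iota>b g) = \<iota> g" for g by (simp add: \<pi>_def \<pi>'(3) s \<iota>c)
  have "\<pi> ` carrier B = carrier X"
  proof
    show "\<pi> ` carrier B \<subseteq> carrier X" using \<pi>c by auto
    have "closed_map B.T X.T \<pi>" using T1_Spaces.continuous_imp_closed_map[OF cont B.compact X.haus] .
    then have "closedin X.T (\<pi> ` carrier B)"
      using closedin_topspace[of B.T] by (simp add: closed_map_def)
    moreover have "range \<iota> \<subseteq> \<pi> ` carrier B" using comm \<iota>bc by (metis image_eqI image_subsetI)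
    ultimately have "X.T closure_of range \<iota> \<subseteq> \<pi> ` carrier B" by (intro closure_of_minimal)
    then show "carrier X \<subseteq> \<pi> ` carrier B" using X by (simp add: group_compactification_def)
  qed
  with hom cont comm show thesis by (rule that)
qed

section \<open>The invariant mean\<close>

text \<open>
  All realizations are compared on one Bohr compactification \<open>B\<close> with its Haar measure.
\<close>

locale bohr_haar =
  fixes B :: "'g::topological_ab_group_add set set top_group" and \<iota>b :: "'g \<Rightarrow> 'g set set" and \<mu>b
  assumes bohr: "bohr_compactification B \<iota>b" and haar_B: "haar_measure B \<mu>b"
begin

lemma compactification_B: "group_compactification B \<iota>b"
  using bohr by (simp add: bohr_compactification_def)

sublocale haar_group B \<mu>b
  using compactification_comm[OF compactification_B] haar_B
  by (simp add: haar_group_def haar_group_axioms_def)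

lemma \<iota>b_carrier: "\<iota>b g \<in> carrier B"
  and \<iota>b_add: "\<iota>b (g + h) = \<iota>b g \<otimes>\<^bsub>B\<^esub> \<iota>b h"
  and \<iota>b_dense: "topol B closure_of range \<iota>b = carrier B"
  using compactification_B by (auto simp: group_compactification_def hom_def)

text \<open>
  The push-forward of the Haar measure of \<open>B\<close> is a Haar measure of \<open>X\<close>, hence the given one.
\<close>

lemma projection:
  fixes X :: "'x top_group"
  assumes X: "group_compactification X \<iota>" and \<mu>: "haar_measure X \<mu>"
  obtains \<pi> where "haar_map B \<mu>b X \<mu> \<pi>" "\<pi> \<in> hom B X" "\<And>g. \<pi> (\<iota>b g) = \<iota> g"
proof -
  interpret X: haar_group X \<mu>
    using compactification_comm[OF X] \<mu> by (simp add: haar_group_def haar_group_axioms_def)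
  obtain \<pi> where \<pi>: "\<pi> \<in> hom B X" "continuous_map (topol B) (topol X) \<pi>" "\<And>g. \<pi> (\<iota>b g) = \<iota> g"
    "\<pi> ` carrier B = carrier X"
    using bohr_universal[OF bohr X] by metis
  let ?S = "sigma (carrier X) {U. openin (topol X) U}"
  have "haar_measure X (distr \<mu>b ?S \<pi>)"
    using compact_ab_group_axioms X.compact_ab_group_axioms haar_B \<pi>(1,2,4) by (rule haar_measure_distr)
  then have "distr \<mu>b ?S \<pi> = \<mu>" using \<mu> by (rule X.haar_measure_unique)
  moreover have "sets ?S = sets \<mu>"
    using X.openin_carrier by (subst sets_measure_of) (auto simp: X.sets_haar)
  ultimately have "distr \<mu>b \<mu> \<pi> = \<mu>"
    using distr_cong[of \<mu>b \<mu>b ?S \<mu> \<pi> \<pi>] by simp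
  then have "haar_map B \<mu>b X \<mu> \<pi>"
    using \<pi>(2) haar_group_axioms X.haar_group_axioms by (simp add: haar_map_def haar_map_axioms_def)
  with \<pi> that show thesis by blast
qed

text \<open>
  The description defining the mean is satisfied by \<open>B\<close> itself. For uniqueness, pull a realization
  on any other compactification back to \<open>B\<close>: the pull-back has the same integral, and it agrees
  almost everywhere with \<open>f\<close> because both restrict to the same function on the base group.
\<close>

lemma hartman_mean_eq:
  assumes f: "riemann_integrable B \<mu>b f"
  shows "hartman_mean (\<lambda>g. f (\<iota>b g)) = (LINT x|completion \<mu>b. f x)"
  unfolding hartman_mean_def
proof (rule the_equality)
  show "\<exists>(X :: 'g set set top_group) \<iota> \<mu> \<phi>s. group_compactification X \<iota> \<and> haar_measure X \<mu> \<and>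
      realization X \<iota> \<mu> \<phi>s (\<lambda>g. f (\<iota>b g)) \<and> (LINT x|completion \<mu>b. f x) = (LINT x|completion \<mu>. \<phi>s x)"
    using compactification_B haar_B f by (intro exI[of _ B] exI[of _ \<iota>b] exI[of _ \<mu>b] exI[of _ f])
      (auto simp: realization_def)
  fix c
  assume "\<exists>(X :: 'g set set top_group) \<iota> \<mu> \<phi>s. group_compactification X \<iota> \<and> haar_measure X \<mu> \<and>
      realization X \<iota> \<mu> \<phi>s (\<lambda>g. f (\<iota>b g)) \<and> c = (LINT x|completion \<mu>. \<phi>s x)"
  then obtain X :: "'g set set top_group" and \<iota> \<mu> \<phi>s where X: "group_compactification X \<iota>" "haar_measure X \<mu>"
    "riemann_integrable X \<mu> \<phi>s" "\<And>g. f (\<iota>b g) = \<phi>s (\<iota> g)" "c = (LINT x|completion \<mu>. \<phi>s x)"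
    by (auto simp: realization_def fun_eq_iff)
  obtain \<pi> where \<pi>: "haar_map B \<mu>b X \<mu> \<pi>" "\<pi> \<in> hom B X" "\<And>g. \<pi> (\<iota>b g) = \<iota> g"
    using projection[OF X(1,2)] by blast
  interpret \<pi>: haar_map B \<mu>b X \<mu> \<pi> by (rule \<pi>(1))
  have ri: "riemann_integrable B \<mu>b (\<lambda>x. \<phi>s (\<pi> x))" using X(3) by (rule \<pi>.riemann_integrable_comp)
  have "AE x in completion \<mu>b. \<phi>s (\<pi> x) = f x"
    using ri f \<iota>b_dense by (rule riemann_integrable_eq_AE) (auto simp: \<pi>(3) X(4))
  then have "(LINT x|completion \<mu>b. \<phi>s (\<pi> x)) = (LINT x|completion \<mu>b. f x)"
    using riemann_integrable_measurable[OF ri] riemann_integrable_measurable[OF f]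
    by (intro integral_cong_AE)
  then show "c = (LINT x|completion \<mu>b. f x)"
    using \<pi>.integral_comp[OF \<pi>.X.riemann_integrable_measurable[OF X(3)]] X(5) by simp
qed

lemma hartman_mean_cmod_diff:
  assumes f: "riemann_integrable B \<mu>b f" and g: "riemann_integrable B \<mu>b g"
  shows "hartman_mean (\<lambda>h. complex_of_real (cmod (f (\<iota>b h) - g (\<iota>b h)))) =
    complex_of_real (L1_norm \<mu>b (\<lambda>x. f x - g x))"
  using hartman_mean_eq[OF riemann_integrable_cmod_diff[OF f g]] by (simp add: L1_norm_def)

lemma hartman_dist_eq:
  assumes f: "riemann_integrable B \<mu>b f"
  shows "hartman_dist (\<lambda>g. f (\<iota>b g)) g = L1_shift f (\<iota>b g)"
  using hartman_mean_cmod_diff[OF f riemann_integrable_translation[OF f \<iota>b_carrier[of g]]]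
  by (simp add: hartman_dist_def L1_shift_def \<iota>b_add)

lemma almost_realization_iff:
  fixes X :: "'x top_group"
  assumes f: "riemann_integrable B \<mu>b f"
    and \<pi>: "haar_map B \<mu>b X \<mu> \<pi>" and \<iota>: "\<And>g. \<pi> (\<iota>b g) = \<iota> g"
    and F: "riemann_integrable X \<mu> F"
  shows "almost_realization X \<iota> \<mu> F (\<lambda>g. f (\<iota>b g)) \<longleftrightarrow> (AE x in completion \<mu>b. f x = F (\<pi> x))"
proof -
  interpret \<pi>: haar_map B \<mu>b X \<mu> \<pi> by (rule \<pi>)
  have ri: "riemann_integrable B \<mu>b (\<lambda>x. F (\<pi> x))" using F by (rule \<pi>.riemann_integrable_comp)
  show ?thesis
    using hartman_mean_cmod_diff[OF f ri] L1_norm_eq_0_iff[OF f ri] F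
    by (simp add: almost_realization_def \<iota>)
qed

end

section \<open>Descent of Riemann integrable functions\<close>

context haar_map
begin

text \<open>
  If all elements of the kernel of \<open>\<pi>\<close> are periods of \<open>f\<close> in the mean, then \<open>f\<close> is almost everywhere
  constant along the fibres, but averaging over fibres would not visibly give an almost everywhere
  continuous function. Instead \<open>F x\<close> is any cluster value of \<open>f y\<close> as \<open>\<pi> y\<close> tends to \<open>x\<close> through continuity
  points \<open>y\<close> of \<open>f\<close>.

  Over a continuity point \<open>x\<close> of \<open>f\<close> there is only one cluster value, namely \<open>f x\<close>. Indeed, let \<open>y\<close> be
  another continuity point with \<open>\<pi> y\<close> near \<open>\<pi> x\<close>, say \<open>y = n \<otimes> v\<close> with \<open>n\<close> in the kernel and \<open>v\<close> near \<open>x\<close>.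
  As \<open>f\<close> and its translate by \<open>n\<close> agree almost everywhere, they agree at some \<open>z\<close> so close to \<open>v\<close> that
  \<open>f z\<close> is near \<open>f x\<close> and \<open>f (n \<otimes> z)\<close> is near \<open>f y\<close>. The same estimate shows that \<open>F\<close>, however the cluster
  values are chosen elsewhere, is continuous at \<open>\<pi> x\<close>. So \<open>F \<circ> \<pi>\<close> equals \<open>f\<close> off the discontinuities
  of \<open>f\<close>, and the discontinuities of \<open>F\<close> pull back into those of \<open>f\<close>.
\<close>

lemma descent:
  fixes f :: "'b \<Rightarrow> complex"
  assumes f: "riemann_integrable B \<mu> f" and hom: "\<pi> \<in> hom B X" and surj: "\<pi> ` carrier B = carrier X"
    and open_map: "open_map (topol B) (topol X) \<pi>"
    and ker: "\<And>n. n \<in> carrier B \<Longrightarrow> \<pi> n = \<one>\<^bsub>X\<^esub> \<Longrightarrow> B.L1_shift f n = 0"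
  obtains F where "riemann_integrable X \<nu> F" "AE x in completion \<mu>. f x = F (\<pi> x)"
proof -
  interpret \<pi>: group_hom B X \<pi> by unfold_locales (rule hom)
  define D where "D = {x \<in> carrier B. \<not> topcontinuous_at (topol B) euclidean f x}"
  have D: "D \<in> null_sets \<mu>" using f by (simp add: riemann_integrable_def D_def)
  obtain M where M: "\<And>x. x \<in> carrier B \<Longrightarrow> cmod (f x) \<le> M"
    using f by (auto simp: riemann_integrable_def bounded_iff)
  have near: "\<exists>V. openin (topol B) V \<and> x \<in> V \<and> (\<forall>y\<in>V. dist (f y) (f x) < e)"
    if "x \<in> carrier B" "x \<notin> D" "e > 0" for x e
    using that by (auto simp: D_def topcontinuous_at_dist)
  have key: "\<exists>U. openin (topol X) U \<and> \<pi> x \<in> U \<and>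
      (\<forall>y\<in>carrier B - D. \<pi> y \<in> U \<longrightarrow> dist (f y) (f x) < e)"
    if x: "x \<in> carrier B" "x \<notin> D" and "e > 0" for x e
  proof -
    obtain V where V: "openin (topol B) V" "x \<in> V" "\<And>y. y \<in> V \<Longrightarrow> dist (f y) (f x) < e / 2"
      using near[OF x, of "e / 2"] \<open>e > 0\<close> by auto
    have "dist (f y) (f x) < e" if y: "y \<in> carrier B" "y \<notin> D" "\<pi> y \<in> \<pi> ` V" for y
    proof -
      obtain W where W: "openin (topol B) W" "y \<in> W" "\<And>z. z \<in> W \<Longrightarrow> dist (f z) (f y) < e / 2"
        using near[OF y(1,2), of "e / 2"] \<open>e > 0\<close> by auto
      obtain v where v: "v \<in> V" "\<pi> y = \<pi> v" using y(3) by blast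
      have vc: "v \<in> carrier B" using v B.openin_carrier[OF V(1)] by blast
      define n where "n = y \<otimes>\<^bsub>B\<^esub> inv\<^bsub>B\<^esub> v"
      have n: "n \<in> carrier B" "\<pi> n = \<one>\<^bsub>X\<^esub>" using y vc v(2) by (auto simp: n_def)
      have nv: "n \<otimes>\<^bsub>B\<^esub> v = y" using y vc by (simp add: n_def B.m_assoc)
      have "AE z in completion \<mu>. f z = f (n \<otimes>\<^bsub>B\<^esub> z)"
        using ker[OF n] B.L1_norm_eq_0_iff[OF f B.riemann_integrable_translation[OF f n(1)]]
        by (simp add: B.L1_shift_def)
      then have "AE z in \<mu>. f z = f (n \<otimes>\<^bsub>B\<^esub> z)" by (simp add: AE_completion_iff)
      then obtain E where E: "E \<in> null_sets \<mu>" "{z \<in> space \<mu>. f z \<noteq> f (n \<otimes>\<^bsub>B\<^esub> z)} \<subseteq> E"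
        unfolding eventually_ae_filter by blast
      let ?V = "V \<inter> {z \<in> carrier B. n \<otimes>\<^bsub>B\<^esub> z \<in> W}"
      have "openin (topol B) ?V"
        using openin_continuous_map_preimage[OF B.translation_cont[OF n(1)] W(1)] V(1) by auto
      moreover have "?V \<noteq> {}" using v nv vc W(2) by auto
      ultimately obtain z where z: "z \<in> ?V" "z \<notin> E" using B.ex_not_in_null_set[OF _ _ E(1)] by blast
      have "f z = f (n \<otimes>\<^bsub>B\<^esub> z)" using z E(2) by auto
      then show ?thesis
        using V(3)[of z] W(3)[of "n \<otimes>\<^bsub>B\<^esub> z"] z(1)
          dist_triangle[of "f y" "f x" "f z"] by (simp add: dist_commute)
    qed
    then show ?thesis
      using open_map V(1,2) by (intro exI[of _ "\<pi> ` V"]) (auto simp: open_map_def)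
  qed
  define cluster where "cluster x c \<longleftrightarrow> (\<forall>e>0. \<forall>U. openin (topol X) U \<longrightarrow> x \<in> U \<longrightarrow>
      (\<exists>y\<in>carrier B - D. \<pi> y \<in> U \<and> dist (f y) c < e))" for x c
  \<comment> \<open>Existence: the closures of the images of the neighborhoods of \<open>x\<close> are nonempty, because continuity
      points are dense, and directed; boundedness of \<open>f\<close> puts them into a compact disc.\<close>
  have cluster_ex: "\<exists>c. cluster x c" if x: "x \<in> carrier X" for x
  proof -
    define \<U> where "\<U> = {U. openin (topol X) U \<and> x \<in> U}"
    define S where "S U = closure (f ` {y \<in> carrier B - D. \<pi> y \<in> U})" for U
    have ne: "\<exists>y\<in>carrier B - D. \<pi> y \<in> U" if U: "U \<in> \<U>" for U
    proof -
      obtain b where b: "b \<in> carrier B" "\<pi> b = x" using x unfolding surj[symmetric] by (elim imageE) simp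
      have "openin (topol B) {b \<in> carrier B. \<pi> b \<in> U}"
        using openin_continuous_map_preimage[OF cont, of U] U by (simp add: \<U>_def)
      moreover have "{b \<in> carrier B. \<pi> b \<in> U} \<noteq> {}" using b U by (auto simp: \<U>_def)
      ultimately show ?thesis using B.ex_not_in_null_set[OF _ _ D] by blast
    qed
    have "cball 0 M \<inter> \<Inter>(S ` \<U>) \<noteq> {}"
    proof (rule compact_imp_fip_image)
      show "compact (cball (0 :: complex) M)" by simp
      show "closed (S U)" for U by (simp add: S_def)
      fix \<V> assume \<V>: "finite \<V>" "\<V> \<subseteq> \<U>"
      have "openin (topol X) (carrier X)" using openin_topspace[of "topol X"] by simp
      then have "openin (topol X) (\<Inter>(insert (carrier X) \<V>))"
        using \<V> by (intro openin_Inter) (auto simp: \<U>_def)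
      then have "\<Inter>(insert (carrier X) \<V>) \<in> \<U>" using \<V> x by (auto simp: \<U>_def)
      then obtain y where y: "y \<in> carrier B - D" "\<pi> y \<in> \<Inter>(insert (carrier X) \<V>)" using ne by blast
      then have "f y \<in> cball 0 M \<inter> \<Inter>(S ` \<V>)"
        using M[of y] unfolding S_def by (auto intro!: closure_subset[THEN subsetD])
      then show "cball 0 M \<inter> \<Inter>(S ` \<V>) \<noteq> {}" by blast
    qed
    then obtain c where c: "\<And>U. U \<in> \<U> \<Longrightarrow> c \<in> S U" by blast
    have "cluster x c"
      unfolding cluster_def
    proof (intro allI impI)
      fix e :: real and U assume "e > 0" "openin (topol X) U" "x \<in> U"
      then show "\<exists>y\<in>carrier B - D. \<pi> y \<in> U \<and> dist (f y) c < e"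
        using c[of U] unfolding S_def \<U>_def closure_approachable by auto
    qed
    then show ?thesis ..
  qed
  define F where "F x = (SOME c. cluster x c)" for x
  have F: "cluster x (F x)" if "x \<in> carrier X" for x
    unfolding F_def using cluster_ex[OF that] by (rule someI_ex)
  have F_near: "\<exists>U. openin (topol X) U \<and> \<pi> x \<in> U \<and> (\<forall>z\<in>U. dist (F z) (f x) < e)"
    if x: "x \<in> carrier B" "x \<notin> D" and "e > 0" for x e
  proof -
    obtain U where U: "openin (topol X) U" "\<pi> x \<in> U"
      "\<And>y. y \<in> carrier B - D \<Longrightarrow> \<pi> y \<in> U \<Longrightarrow> dist (f y) (f x) < e / 2"
      using key[OF x, of "e / 2"] \<open>e > 0\<close> by auto
    have "dist (F z) (f x) < e" if z: "z \<in> U" for z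
    proof -
      have "z \<in> carrier X" using z X.openin_carrier[OF U(1)] by blast
      then obtain y where "y \<in> carrier B - D" "\<pi> y \<in> U" "dist (f y) (F z) < e / 2"
        using F[of z] U(1) z \<open>e > 0\<close> unfolding cluster_def by (meson half_gt_zero)
      then show ?thesis using U(3)[of y] by (metis dist_triangle_half_r)
    qed
    then show ?thesis using U(1,2) by blast
  qed
  have F_eq: "F (\<pi> x) = f x" if x: "x \<in> carrier B" "x \<notin> D" for x
  proof (rule ccontr)
    assume "F (\<pi> x) \<noteq> f x"
    then show False using F_near[OF x, of "dist (F (\<pi> x)) (f x)"] by auto
  qed
  let ?E = "{x \<in> carrier X. \<not> topcontinuous_at (topol X) euclidean F x}"
  have E: "?E \<in> sets \<nu>"
    using sets_discontinuities[of \<nu> "topol X" F] by (simp add: X.sets_haar)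
  have "\<pi> -` ?E \<inter> space \<mu> \<subseteq> D"
  proof (rule ccontr)
    assume "\<not> \<pi> -` ?E \<inter> space \<mu> \<subseteq> D"
    then obtain x where x: "x \<in> carrier B" "x \<notin> D" "\<not> topcontinuous_at (topol X) euclidean F (\<pi> x)" by auto
    then show False
      using F_near[OF x(1,2)] F_eq[OF x(1,2)] by (simp add: topcontinuous_at_dist)
  qed
  then have "\<pi> -` ?E \<inter> space \<mu> \<in> null_sets \<mu>"
    using measurable_sets[OF measurable E] null_sets_subset[OF D] by blast
  then have "?E \<in> null_sets \<nu>"
    using null_sets_distr_iff[OF measurable, of ?E] E distr by simp
  moreover have "bounded (F ` carrier X)"
  proof -
    have "cmod (F x) \<le> M + 1" if x: "x \<in> carrier X" for x
    proof -
      have "openin (topol X) (carrier X)" using openin_topspace[of "topol X"] by simp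
      then obtain y where "y \<in> carrier B" "dist (f y) (F x) < 1"
        using F[OF x] x unfolding cluster_def by (metis DiffD1 zero_less_one)
      then show ?thesis
        using M[of y] norm_triangle_ineq2[of "F x" "f y"] by (simp add: dist_norm norm_minus_commute)
    qed
    then show ?thesis by (auto simp: bounded_iff)
  qed
  ultimately have "riemann_integrable X \<nu> F" by (simp add: riemann_integrable_def)
  moreover have "AE x in completion \<mu>. f x = F (\<pi> x)"
  proof (rule AE_completion)
    show "AE x in \<mu>. f x = F (\<pi> x)"
    proof (rule AE_I'[OF D], rule subsetI, rule ccontr)
      fix x assume "x \<in> {x \<in> space \<mu>. f x \<noteq> F (\<pi> x)}" "x \<notin> D"
      then show False using F_eq[of x] by simp
    qed
  qed
  ultimately show thesis by (rule that)
qed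

end

lemma (in haar_map) aperiodic_descent:
  assumes f: "riemann_integrable B \<mu> f" and hom: "\<pi> \<in> hom B X" and surj: "\<pi> ` carrier B = carrier X"
    and ker: "\<And>x. x \<in> carrier B \<Longrightarrow> B.L1_shift f x = 0 \<longleftrightarrow> \<pi> x = \<one>\<^bsub>X\<^esub>"
    and F: "riemann_integrable X \<nu> F" and eq: "AE x in completion \<mu>. f x = F (\<pi> x)"
  shows "aperiodic X \<nu> F"
proof -
  have *: "X.L1_shift F (\<pi> x) = 0 \<longleftrightarrow> \<pi> x = \<one>\<^bsub>X\<^esub>" if x: "x \<in> carrier B" for x
    using L1_shift_comp[OF hom F x] ker[OF x]
      B.L1_shift_cong_AE[OF f riemann_integrable_comp[OF F] eq x] by simp
  have "X.L1_shift F y = 0 \<longleftrightarrow> y = \<one>\<^bsub>X\<^esub>" if y: "y \<in> carrier X" for y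
  proof -
    obtain x where "x \<in> carrier B" "y = \<pi> x" using y unfolding surj[symmetric] by (elim imageE) simp
    then show ?thesis using * by simp
  qed
  then show ?thesis using X.one_closed unfolding aperiodic_def X.L1_shift_def[symmetric] by blast
qed


section \<open>Existence of aperiodic almost realizations\<close>

context bohr_haar
begin

text \<open>
  Divide \<open>B\<close> by the closed subgroup \<open>N\<close> of all periods of \<open>f\<close> in the mean. The periods of the function \<open>F\<close>
  obtained by descent pull back to \<open>N\<close>, so only the unit of the quotient remains.
\<close>

lemma ex_aperiodic_almost_realization:
  assumes f: "riemann_integrable B \<mu>b f"
  shows "\<exists>(X :: 'g set set top_group) \<iota> \<mu> F. group_compactification X \<iota> \<and> haar_measure X \<mu> \<and>
    almost_realization X \<iota> \<mu> F (\<lambda>g. f (\<iota>b g)) \<and> aperiodic X \<mu> F"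
proof -
  define N where "N = {x \<in> carrier B. L1_shift f x = 0}"
  note N = period_subgroup[OF f, folded N_def]
  interpret N: subgroup N B by (rule N(1))
  \<comment> \<open>The choice depends only on the coset of \<open>x\<close>; its value represents that coset in the carrier
      of the quotient.\<close>
  define r where "r x = (SOME y. y \<in> carrier B \<and> x \<otimes>\<^bsub>B\<^esub> inv\<^bsub>B\<^esub> y \<in> N)" for x
  have r: "r x \<in> carrier B" "x \<otimes>\<^bsub>B\<^esub> inv\<^bsub>B\<^esub> r x \<in> N" if "x \<in> carrier B" for x
  proof -
    have "x \<in> carrier B \<and> x \<otimes>\<^bsub>B\<^esub> inv\<^bsub>B\<^esub> x \<in> N" using that by simp
    then have "r x \<in> carrier B \<and> x \<otimes>\<^bsub>B\<^esub> inv\<^bsub>B\<^esub> r x \<in> N" unfolding r_def by (rule someI)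
    then show "r x \<in> carrier B" "x \<otimes>\<^bsub>B\<^esub> inv\<^bsub>B\<^esub> r x \<in> N" by auto
  qed
  have N_trans: "x \<otimes>\<^bsub>B\<^esub> inv\<^bsub>B\<^esub> z \<in> N"
    if "x \<otimes>\<^bsub>B\<^esub> inv\<^bsub>B\<^esub> y \<in> N" "y \<otimes>\<^bsub>B\<^esub> inv\<^bsub>B\<^esub> z \<in> N" "x \<in> carrier B" "y \<in> carrier B" "z \<in> carrier B" for x y z
  proof -
    have "(x \<otimes>\<^bsub>B\<^esub> inv\<^bsub>B\<^esub> y) \<otimes>\<^bsub>B\<^esub> (y \<otimes>\<^bsub>B\<^esub> inv\<^bsub>B\<^esub> z) = x \<otimes>\<^bsub>B\<^esub> inv\<^bsub>B\<^esub> z"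
      using that(3-5) by (simp add: m_assoc) (simp add: m_assoc[symmetric])
    then show ?thesis using N.m_closed[OF that(1,2)] by simp
  qed
  have N_sym: "y \<otimes>\<^bsub>B\<^esub> inv\<^bsub>B\<^esub> x \<in> N" if "x \<otimes>\<^bsub>B\<^esub> inv\<^bsub>B\<^esub> y \<in> N" "x \<in> carrier B" "y \<in> carrier B" for x y
    using N.m_inv_closed[OF that(1)] that(2,3) by (simp add: inv_mult_group)
  interpret q: closed_quotient B r N
  proof (intro closed_quotient.intro closed_quotient_axioms.intro compact_ab_group_axioms N)
    fix x y assume xy: "x \<in> carrier B" "y \<in> carrier B"
    show "r x = r y \<longleftrightarrow> x \<otimes>\<^bsub>B\<^esub> inv\<^bsub>B\<^esub> y \<in> N"
    proof
      assume "r x = r y"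
      then show "x \<otimes>\<^bsub>B\<^esub> inv\<^bsub>B\<^esub> y \<in> N" using r[OF xy(1)] r[OF xy(2)] xy N_trans N_sym by metis
    next
      assume "x \<otimes>\<^bsub>B\<^esub> inv\<^bsub>B\<^esub> y \<in> N"
      then have "(z \<in> carrier B \<and> x \<otimes>\<^bsub>B\<^esub> inv\<^bsub>B\<^esub> z \<in> N) \<longleftrightarrow> (z \<in> carrier B \<and> y \<otimes>\<^bsub>B\<^esub> inv\<^bsub>B\<^esub> z \<in> N)" for z
        using xy N_trans N_sym by metis
      then show "r x = r y" unfolding r_def by simp
    qed
  qed
  define \<mu> where "\<mu> = distr \<mu>b (sigma (carrier q.Q) {U. openin (topol q.Q) U}) r"
  have \<mu>: "haar_measure q.Q \<mu>"
    unfolding \<mu>_def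
    by (rule haar_measure_distr[OF compact_ab_group_axioms q.compact_ab_group_Q haar_B q.hom_Q q.cont_Q]) simp
  have X: "group_compactification q.Q (r \<circ> \<iota>b)"
    using compactification_B by (rule q.group_compactification_Q)
  have "sets \<mu> = sets (sigma (carrier q.Q) {U. openin (topol q.Q) U})" by (simp add: \<mu>_def)
  then have "distr \<mu>b \<mu> r = \<mu>"
    unfolding \<mu>_def by (intro distr_cong) auto
  then have map: "haar_map B \<mu>b q.Q \<mu> r"
    using q.cont_Q haar_group_axioms q.compact_ab_group_Q \<mu>
    by (simp add: haar_map_def haar_map_axioms_def haar_group_def haar_group_axioms_def)
  have ker: "L1_shift f x = 0 \<longleftrightarrow> r x = \<one>\<^bsub>q.Q\<^esub>" if x: "x \<in> carrier B" for x
  proof -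
    have "r x = r \<one>\<^bsub>B\<^esub> \<longleftrightarrow> x \<otimes>\<^bsub>B\<^esub> inv\<^bsub>B\<^esub> \<one>\<^bsub>B\<^esub> \<in> N" using x one_closed by (rule q.fibre)
    also have "x \<otimes>\<^bsub>B\<^esub> inv\<^bsub>B\<^esub> \<one>\<^bsub>B\<^esub> = x" using x by simp
    also have "x \<in> N \<longleftrightarrow> L1_shift f x = 0" using x unfolding N_def by blast
    finally show ?thesis unfolding q.one_Q by (rule sym)
  qed
  obtain F where F: "riemann_integrable q.Q \<mu> F" "AE x in completion \<mu>b. f x = F (r x)"
    by (rule haar_map.descent[OF map f q.hom_Q q.carrier_Q[symmetric] q.open_map_Q]) (use ker in auto)
  have "almost_realization q.Q (r \<circ> \<iota>b) \<mu> F (\<lambda>g. f (\<iota>b g))"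
    using almost_realization_iff[OF f map _ F(1)] F(2) by simp
  moreover have "aperiodic q.Q \<mu> F"
    by (rule haar_map.aperiodic_descent[OF map f q.hom_Q q.carrier_Q[symmetric] ker F])
  ultimately show ?thesis using X \<mu> by blast
qed

end

section \<open>The two filters\<close>

lemma eventually_compactification_filter:
  assumes "compact_group X"
  shows "eventually P (compactification_filter X \<iota>) \<longleftrightarrow>
    (\<exists>V. openin (topol X) V \<and> \<one>\<^bsub>X\<^esub> \<in> V \<and> (\<forall>g. \<iota> g \<in> V \<longrightarrow> P g))"
proof -
  have ts: "topspace (topol X) = carrier X" "\<one>\<^bsub>X\<^esub> \<in> carrier X"
    using assms by (auto simp: compact_group_def group.is_monoid monoid.one_closed)
  let ?\<U> = "{U. U \<subseteq> carrier X \<and> (\<exists>V. openin (topol X) V \<and> \<one>\<^bsub>X\<^esub> \<in> V \<and> V \<subseteq> U)}"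
  have "eventually P (compactification_filter X \<iota>) \<longleftrightarrow>
      (\<exists>U\<in>?\<U>. eventually P (principal (\<iota> -` U)))"
    unfolding compactification_filter_def
  proof (rule eventually_INF_base)
    have "carrier X \<in> ?\<U>" using ts openin_topspace[of "topol X"] by auto
    then show "?\<U> \<noteq> {}" by blast
    fix U V assume U: "U \<in> ?\<U>" and V: "V \<in> ?\<U>"
    then obtain U' V' where "openin (topol X) U'" "\<one>\<^bsub>X\<^esub> \<in> U'" "U' \<subseteq> U"
      "openin (topol X) V'" "\<one>\<^bsub>X\<^esub> \<in> V'" "V' \<subseteq> V" by blast
    then have "openin (topol X) (U' \<inter> V') \<and> \<one>\<^bsub>X\<^esub> \<in> U' \<inter> V' \<and> U' \<inter> V' \<subseteq> U \<inter> V" by auto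
    then have "U \<inter> V \<in> ?\<U>" using U by blast
    then show "\<exists>W\<in>?\<U>. principal (\<iota> -` W) \<le> inf (principal (\<iota> -` U)) (principal (\<iota> -` V))"
      by (intro bexI[of _ "U \<inter> V"]) auto
  qed
  also have "\<dots> \<longleftrightarrow> (\<exists>V. openin (topol X) V \<and> \<one>\<^bsub>X\<^esub> \<in> V \<and> (\<forall>g. \<iota> g \<in> V \<longrightarrow> P g))"
  proof
    assume "\<exists>U\<in>?\<U>. eventually P (principal (\<iota> -` U))"
    then obtain U V where "openin (topol X) V" "\<one>\<^bsub>X\<^esub> \<in> V" "V \<subseteq> U" "\<And>g. \<iota> g \<in> U \<Longrightarrow> P g"
      by (auto simp: eventually_principal)
    then show "\<exists>V. openin (topol X) V \<and> \<one>\<^bsub>X\<^esub> \<in> V \<and> (\<forall>g. \<iota> g \<in> V \<longrightarrow> P g)" by blast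
  next
    assume "\<exists>V. openin (topol X) V \<and> \<one>\<^bsub>X\<^esub> \<in> V \<and> (\<forall>g. \<iota> g \<in> V \<longrightarrow> P g)"
    then obtain V where V: "openin (topol X) V" "\<one>\<^bsub>X\<^esub> \<in> V" "\<And>g. \<iota> g \<in> V \<Longrightarrow> P g" by blast
    then have "V \<in> ?\<U>" using openin_subset[OF V(1)] ts by auto
    then show "\<exists>U\<in>?\<U>. eventually P (principal (\<iota> -` U))"
      using V(3) by (intro bexI[of _ V]) (auto simp: eventually_principal)
  qed
  finally show ?thesis .
qed

text \<open>
  For an aperiodic \<open>f\<close> the continuous function \<open>L1_shift f\<close> is positive on the compact complement of \<open>V\<close>,
  hence bounded below there by some \<open>\<epsilon> > 0\<close>.
\<close>

lemma (in haar_group) aperiodic_nbhd: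
  assumes f: "riemann_integrable X \<mu> f" and ap: "aperiodic X \<mu> f"
    and V: "openin T V" "\<one> \<in> V"
  obtains \<epsilon> where "\<epsilon> > 0" "\<And>x. x \<in> carrier X \<Longrightarrow> L1_shift f x < \<epsilon> \<Longrightarrow> x \<in> V"
proof -
  let ?I = "L1_shift f ` (carrier X - V)"
  have "compactin T (carrier X - V)"
    using closedin_compact_space[OF compact closed_complement[OF V(1)]] .
  then have "closed ?I"
    using image_compactin[OF _ L1_shift_continuous[OF f]] by (auto intro: compact_imp_closed)
  moreover have "0 \<notin> ?I"
  proof
    assume "0 \<in> ?I"
    then obtain x where x: "x \<in> carrier X" "x \<notin> V" "L1_shift f x = 0" by auto
    then have "x \<in> {\<one>}" using ap unfolding aperiodic_def L1_shift_def[symmetric] by blast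
    then show False using x(2) V(2) by simp
  qed
  ultimately obtain \<epsilon> where \<epsilon>: "\<epsilon> > 0" "\<And>y. y \<in> ?I \<Longrightarrow> \<epsilon> \<le> dist 0 y"
    using separate_point_closed by metis
  show thesis
  proof (rule that[OF \<epsilon>(1)], rule ccontr)
    fix x assume "x \<in> carrier X" "L1_shift f x < \<epsilon>" "x \<notin> V"
    then show False using \<epsilon>(2)[of "L1_shift f x"] L1_shift_nonneg[of f x] by simp
  qed
qed

text \<open>
  Almost realizations have the same translation distances as realizations, so \<open>d\<^sub>\<phi> g = L1_shift F (\<iota> g)\<close>.
  Continuity of \<open>L1_shift F\<close> at \<open>\<one>\<close> gives one inclusion of the filters, aperiodicity the other.
\<close>

lemma (in bohr_haar) hartman_filter_eq:
  fixes X :: "'x top_group"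
  assumes f: "riemann_integrable B \<mu>b f"
    and X: "group_compactification X \<iota>" and \<mu>: "haar_measure X \<mu>"
    and F: "almost_realization X \<iota> \<mu> F (\<lambda>g. f (\<iota>b g))" and ap: "aperiodic X \<mu> F"
  shows "hartman_filter (\<lambda>g. f (\<iota>b g)) = compactification_filter X \<iota>"
proof -
  obtain \<pi> where \<pi>: "haar_map B \<mu>b X \<mu> \<pi>" "\<pi> \<in> hom B X" "\<And>g. \<pi> (\<iota>b g) = \<iota> g"
    using projection[OF X \<mu>] by blast
  interpret \<pi>: haar_map B \<mu>b X \<mu> \<pi> by (rule \<pi>(1))
  have riF: "riemann_integrable X \<mu> F" using F by (simp add: almost_realization_def)
  have AE: "AE x in completion \<mu>b. f x = F (\<pi> x)"
    using almost_realization_iff[OF f \<pi>(1) \<pi>(3) riF] F by simp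
  have dist: "hartman_dist (\<lambda>g. f (\<iota>b g)) g = \<pi>.X.L1_shift F (\<iota> g)" for g
    using hartman_dist_eq[OF f] \<pi>.L1_shift_comp[OF \<pi>(2) riF \<iota>b_carrier[of g]]
      L1_shift_cong_AE[OF f \<pi>.riemann_integrable_comp[OF riF] AE \<iota>b_carrier[of g]] \<pi>(3) by simp
  have \<iota>c: "\<iota> g \<in> carrier X" for g using X by (auto simp: group_compactification_def hom_def)
  show ?thesis
  proof (rule filter_eqI)
    fix P
    show "eventually P (hartman_filter (\<lambda>g. f (\<iota>b g))) = eventually P (compactification_filter X \<iota>)"
      unfolding eventually_hartman_filter eventually_compactification_filter[OF \<pi>.X.compact_group] dist
    proof
      assume "\<exists>\<epsilon>>0. {g. \<pi>.X.L1_shift F (\<iota> g) < \<epsilon>} \<subseteq> Collect P"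
      then obtain \<epsilon> where "\<epsilon> > 0" "\<And>g. \<pi>.X.L1_shift F (\<iota> g) < \<epsilon> \<Longrightarrow> P g" by blast
      moreover obtain V where "openin \<pi>.X.T V" "\<one>\<^bsub>X\<^esub> \<in> V" "\<And>v. v \<in> V \<Longrightarrow> \<pi>.X.L1_shift F v < \<epsilon>"
        using \<pi>.X.L1_shift_small[OF riF \<open>\<epsilon> > 0\<close>] by blast
      ultimately show "\<exists>V. openin \<pi>.X.T V \<and> \<one>\<^bsub>X\<^esub> \<in> V \<and> (\<forall>g. \<iota> g \<in> V \<longrightarrow> P g)" by blast
    next
      assume "\<exists>V. openin \<pi>.X.T V \<and> \<one>\<^bsub>X\<^esub> \<in> V \<and> (\<forall>g. \<iota> g \<in> V \<longrightarrow> P g)"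
      then obtain V where V: "openin \<pi>.X.T V" "\<one>\<^bsub>X\<^esub> \<in> V" "\<And>g. \<iota> g \<in> V \<Longrightarrow> P g" by blast
      obtain \<epsilon> where "\<epsilon> > 0" "\<And>x. x \<in> carrier X \<Longrightarrow> \<pi>.X.L1_shift F x < \<epsilon> \<Longrightarrow> x \<in> V"
        using \<pi>.X.aperiodic_nbhd[OF riF ap V(1,2)] by blast
      then show "\<exists>\<epsilon>>0. {g. \<pi>.X.L1_shift F (\<iota> g) < \<epsilon>} \<subseteq> Collect P"
        using V(3) \<iota>c by blast
    qed
  qed
qed

theorem theorem2:
  fixes \<phi> :: "'g::{topological_ab_group_add, t2_space} \<Rightarrow> complex"
  assumes "locally_compact_space (euclidean :: 'g topology)"
    and "hartman_measurable \<phi>"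
  shows "(\<exists>(X :: 'g set set top_group) \<iota> \<mu> \<phi>s.
            group_compactification X \<iota> \<and> haar_measure X \<mu> \<and>
            almost_realization X \<iota> \<mu> \<phi>s \<phi> \<and> aperiodic X \<mu> \<phi>s) \<and>
         (\<forall>(X :: 'x top_group) \<iota> \<mu> \<phi>s.
            group_compactification X \<iota> \<and> haar_measure X \<mu> \<and>
            almost_realization X \<iota> \<mu> \<phi>s \<phi> \<and> aperiodic X \<mu> \<phi>s \<longrightarrow>
            hartman_filter \<phi> = compactification_filter X \<iota>)"
proof -
  obtain B :: "'g set set top_group" and \<iota>b \<mu>b \<phi>b where
    B: "bohr_compactification B \<iota>b" "haar_measure B \<mu>b" "realization B \<iota>b \<mu>b \<phi>b \<phi>"
    using assms(2) unfolding hartman_measurable_def by blast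
  interpret bohr_haar B \<iota>b \<mu>b using B by unfold_locales
  have ri: "riemann_integrable B \<mu>b \<phi>b" and \<phi>: "\<phi> = (\<lambda>g. \<phi>b (\<iota>b g))"
    using B(3) by (auto simp: realization_def)
  show ?thesis
    unfolding \<phi> using ex_aperiodic_almost_realization[OF ri] hartman_filter_eq[OF ri] by blast
qed

end
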